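(* Let $d\ge1$ be an integer. If $\beta>1$ and $b$ is an automorphism of the unit ball $\mathbb B_d$, then $\mathcal H_\beta(b)$ is compactly embedded in $\mathcal H_\beta$.
   Context: $\mathbb B_d$ is the open unit ball in $\mathbb C^d$; an automorphism of $\mathbb B_d$ is a biholomorphic map of $\mathbb B_d$ onto itself, regarded as a $\mathbb C^d$-valued row function $b=(b_1,\dots,b_d)$. $\mathcal H_\beta$ is the Hilbert space of holomorphic functions on $\mathbb B_d$ with reproducing kernel $s^\beta(z,w)=(1-\langle z,w\rangle)^{-\beta}$, and $\mathcal H_\beta(b)$ is the Hilbert function space on $\mathbb B_d$ with reproducing kernel $s^\beta(z,w)(1-b(z)b(w)^* )$, where $b(z)b(w)^*=\langle b(z),b(w)\rangle_{\mathbb C^d}$. *)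

theory Defs
  imports "HOL-Analysis.Analysis"
begin

text \<open>
  A function on \<open>X\<close> is represented by a total function that vanishes outside \<open>X\<close>, so that equality
  of functions on \<open>X\<close> is equality in HOL. The inner product is linear in its first argument; its
  values are only constrained on \<open>H\<close>.
\<close>

locale pre_hilbert_function_space =
  fixes X :: "'a set" and H :: "('a \<Rightarrow> complex) set"
    and ip :: "('a \<Rightarrow> complex) \<Rightarrow> ('a \<Rightarrow> complex) \<Rightarrow> complex"
  assumes outside: "f \<in> H \<Longrightarrow> x \<notin> X \<Longrightarrow> f x = 0"
    and zero_mem: "(\<lambda>_. 0) \<in> H"
    and add_mem: "f \<in> H \<Longrightarrow> g \<in> H \<Longrightarrow> (\<lambda>x. f x + g x) \<in> H"
    and scale_mem: "f \<in> H \<Longrightarrow> (\<lambda>x. c * f x) \<in> H"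
    and ip_add_left: "f \<in> H \<Longrightarrow> g \<in> H \<Longrightarrow> h \<in> H \<Longrightarrow> ip (\<lambda>x. f x + g x) h = ip f h + ip g h"
    and ip_scale_left: "f \<in> H \<Longrightarrow> h \<in> H \<Longrightarrow> ip (\<lambda>x. c * f x) h = c * ip f h"
    and ip_commute: "f \<in> H \<Longrightarrow> h \<in> H \<Longrightarrow> ip h f = cnj (ip f h)"
    and ip_pos: "f \<in> H \<Longrightarrow> f \<noteq> (\<lambda>_. 0) \<Longrightarrow> 0 < Re (ip f f)"

definition ip_norm :: "(('a \<Rightarrow> complex) \<Rightarrow> ('a \<Rightarrow> complex) \<Rightarrow> complex) \<Rightarrow> ('a \<Rightarrow> complex) \<Rightarrow> real"
  where "ip_norm ip f = sqrt (Re (ip f f))"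

text \<open>The distance is set to \<open>0\<close> off \<open>H\<close> because \<^locale>\<open>Metric_space\<close> asks for nonnegativity and
  symmetry everywhere.\<close>

definition ip_dist ::
    "('a \<Rightarrow> complex) set \<Rightarrow> (('a \<Rightarrow> complex) \<Rightarrow> ('a \<Rightarrow> complex) \<Rightarrow> complex)
      \<Rightarrow> ('a \<Rightarrow> complex) \<Rightarrow> ('a \<Rightarrow> complex) \<Rightarrow> real"
  where "ip_dist H ip f g = (if f \<in> H \<and> g \<in> H then ip_norm ip (\<lambda>x. f x - g x) else 0)"

context pre_hilbert_function_space
begin

lemma diff_mem: "f \<in> H \<Longrightarrow> g \<in> H \<Longrightarrow> (\<lambda>x. f x - g x) \<in> H"
  using add_mem[of f "\<lambda>x. (-1) * g x"] scale_mem[of g "-1"] by simp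

lemma ip_add_right:
  "f \<in> H \<Longrightarrow> g \<in> H \<Longrightarrow> h \<in> H \<Longrightarrow> ip h (\<lambda>x. f x + g x) = ip h f + ip h g"
  using ip_commute[OF add_mem, of f g h] ip_commute[of f h] ip_commute[of g h] ip_add_left[of f g h]
  by simp

lemma ip_scale_right: "f \<in> H \<Longrightarrow> h \<in> H \<Longrightarrow> ip h (\<lambda>x. c * f x) = cnj c * ip h f"
  using ip_commute[OF scale_mem, of f h c] ip_commute[of f h] ip_scale_left[of f h c]
  by simp

lemma ip_zero: "ip (\<lambda>_. 0) (\<lambda>_. 0) = 0"
  using ip_scale_left[OF zero_mem zero_mem, of 0] by simp

lemma ip_nonneg: "f \<in> H \<Longrightarrow> 0 \<le> Re (ip f f)"
  using ip_pos[of f] ip_zero by (cases "f = (\<lambda>_. 0)") auto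

lemma ip_self_eq_0: "f \<in> H \<Longrightarrow> Re (ip f f) = 0 \<longleftrightarrow> f = (\<lambda>_. 0)"
  using ip_pos[of f] ip_zero by (cases "f = (\<lambda>_. 0)") auto

lemma ip_expand:
  assumes "f \<in> H" "g \<in> H"
  shows "Re (ip (\<lambda>x. f x + of_real t * g x) (\<lambda>x. f x + of_real t * g x))
    = Re (ip f f) + 2 * t * Re (ip f g) + t\<^sup>2 * Re (ip g g)"
proof -
  let ?h = "\<lambda>x. of_real t * g x"
  have h: "?h \<in> H" using assms scale_mem by blast
  have "ip (\<lambda>x. f x + ?h x) (\<lambda>x. f x + ?h x) = (ip f f + ip f ?h) + (ip ?h f + ip ?h ?h)"
    by (simp only: ip_add_left[OF assms(1) h add_mem[OF assms(1) h]]
        ip_add_right[OF assms(1) h assms(1)] ip_add_right[OF assms(1) h h])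
  moreover have "ip f ?h = of_real t * ip f g"
    using ip_scale_right[OF assms(2,1), of "of_real t"] by simp
  moreover have "ip ?h f = of_real t * cnj (ip f g)"
    using ip_scale_left[OF assms(2,1), of "of_real t"] ip_commute[OF assms] by simp
  moreover have "ip ?h ?h = of_real t * (of_real t * ip g g)"
    using ip_scale_left[OF assms(2) h, of "of_real t"] ip_scale_right[OF assms(2,2), of "of_real t"]
    by simp
  ultimately show ?thesis
    by (simp add: power2_eq_square)
qed

lemma Re_ip_le:
  assumes "f \<in> H" "g \<in> H"
  shows "Re (ip f g) \<le> ip_norm ip f * ip_norm ip g"
proof (cases "Re (ip g g) = 0")
  case True
  then have "g = (\<lambda>_. 0)" using ip_self_eq_0 assms by simp
  then show ?thesis
    using ip_scale_right[of "\<lambda>_. 0" f 0] assms ip_zero by (simp add: ip_norm_def)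
next
  case False
  define a b c where "a = Re (ip f f)" and "b = Re (ip f g)" and "c = Re (ip g g)"
  have c: "c > 0" using False ip_nonneg[of g] assms by (simp add: c_def)
  define t where "t = - b / c"
  have tc: "t * c = - b" using c by (simp add: t_def)
  have "0 \<le> a + 2 * t * b + t\<^sup>2 * c"
    using ip_nonneg[OF add_mem[OF assms(1) scale_mem[OF assms(2), of "of_real t"]]]
    unfolding ip_expand[OF assms] a_def b_def c_def .
  also have "\<dots> = a + t * b"
    using tc by (simp add: power2_eq_square mult.assoc)
  finally have "0 \<le> (a + t * b) * c"
    using c by simp
  also have "\<dots> = a * c + (t * c) * b"
    by (simp add: algebra_simps)
  finally have "b\<^sup>2 \<le> a * c"
    by (simp add: tc power2_eq_square)
  then have "b \<le> sqrt (a * c)"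
    by (rule real_le_rsqrt)
  then show ?thesis
    by (simp add: ip_norm_def a_def b_def c_def real_sqrt_mult)
qed

lemma ip_norm_add:
  assumes "f \<in> H" "g \<in> H"
  shows "ip_norm ip (\<lambda>x. f x + g x) \<le> ip_norm ip f + ip_norm ip g"
proof -
  have "Re (ip (\<lambda>x. f x + g x) (\<lambda>x. f x + g x)) = Re (ip f f) + 2 * Re (ip f g) + Re (ip g g)"
    using ip_expand[OF assms, of 1] by (simp only: of_real_1 mult_1 mult_1_right power_one)
  also have "\<dots> \<le> (ip_norm ip f + ip_norm ip g)\<^sup>2"
    using Re_ip_le[OF assms] ip_nonneg[OF assms(1)] ip_nonneg[OF assms(2)]
    by (simp add: ip_norm_def power2_sum)
  finally have "sqrt (Re (ip (\<lambda>x. f x + g x) (\<lambda>x. f x + g x))) \<le> ip_norm ip f + ip_norm ip g"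
    using ip_nonneg[OF assms(1)] ip_nonneg[OF assms(2)]
    by (intro real_le_lsqrt) (simp_all add: ip_norm_def)
  then show ?thesis
    by (simp only: ip_norm_def)
qed

sublocale Metric_space H "ip_dist H ip"
proof
  fix f g :: "'a \<Rightarrow> complex"
  show "0 \<le> ip_dist H ip f g"
    by (simp add: ip_dist_def ip_norm_def diff_mem ip_nonneg)
  show "ip_dist H ip f g = ip_dist H ip g f"
  proof (cases "f \<in> H \<and> g \<in> H")
    case True
    then have d: "(\<lambda>x. f x - g x) \<in> H" by (simp add: diff_mem)
    have "(\<lambda>x. g x - f x) = (\<lambda>x. (-1) * (f x - g x))" by auto
    then have "ip (\<lambda>x. g x - f x) (\<lambda>x. g x - f x)
        = (-1) * (cnj (-1) * ip (\<lambda>x. f x - g x) (\<lambda>x. f x - g x))"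
      by (simp only: ip_scale_left[OF d scale_mem[OF d]] ip_scale_right[OF d d])
    then show ?thesis using True by (simp add: ip_dist_def ip_norm_def)
  qed (auto simp: ip_dist_def)
next
  fix f g assume "f \<in> H" "g \<in> H"
  then show "ip_dist H ip f g = 0 \<longleftrightarrow> f = g"
    using ip_self_eq_0[OF diff_mem, of f g]
    by (auto simp: ip_dist_def ip_norm_def fun_eq_iff)
next
  fix f g h assume "f \<in> H" "g \<in> H" "h \<in> H"
  then show "ip_dist H ip f h \<le> ip_dist H ip f g + ip_dist H ip g h"
    using ip_norm_add[OF diff_mem diff_mem, of f g g h] by (simp add: ip_dist_def)
qed

end

definition is_reproducing_kernel ::
    "'a set \<Rightarrow> ('a \<Rightarrow> 'a \<Rightarrow> complex) \<Rightarrow> ('a \<Rightarrow> complex) set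
      \<Rightarrow> (('a \<Rightarrow> complex) \<Rightarrow> ('a \<Rightarrow> complex) \<Rightarrow> complex) \<Rightarrow> bool"
  where "is_reproducing_kernel X K H ip \<longleftrightarrow>
    (\<forall>w\<in>X. (\<lambda>z. if z \<in> X then K z w else 0) \<in> H \<and>
      (\<forall>f\<in>H. f w = ip f (\<lambda>z. if z \<in> X then K z w else 0)))"

locale hilbert_function_space = pre_hilbert_function_space X H ip
  for X :: "'a set" and H ip +
  fixes K :: "'a \<Rightarrow> 'a \<Rightarrow> complex"
  assumes complete: "Metric_space.mcomplete H (ip_dist H ip)"
    and kernel: "is_reproducing_kernel X K H ip"

text \<open>\<open>H2\<close> is contained in \<open>H1\<close> and the inclusion is a compact operator: the closed unit ball
  of \<open>H2\<close> is relatively compact in the norm topology of \<open>H1\<close>.\<close>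

definition compactly_embedded ::
    "('a \<Rightarrow> complex) set \<Rightarrow> (('a \<Rightarrow> complex) \<Rightarrow> ('a \<Rightarrow> complex) \<Rightarrow> complex)
      \<Rightarrow> ('a \<Rightarrow> complex) set \<Rightarrow> (('a \<Rightarrow> complex) \<Rightarrow> ('a \<Rightarrow> complex) \<Rightarrow> complex) \<Rightarrow> bool"
  where "compactly_embedded H2 ip2 H1 ip1 \<longleftrightarrow> H2 \<subseteq> H1 \<and>
    (let T = Metric_space.mtopology H1 (ip_dist H1 ip1)
     in compactin T (T closure_of {f \<in> H2. ip_norm ip2 f \<le> 1}))"

text \<open>The norm of \<^typ>\<open>complex^'d\<close> is the Euclidean one, so \<open>ball 0 1\<close> is the open unit ball.\<close>

definition hprod :: "complex^'d \<Rightarrow> complex^'d \<Rightarrow> complex"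
  where "hprod z w = (\<Sum>i\<in>UNIV. z $ i * cnj (w $ i))"

text \<open>Complex Frechet differentiability; \<open>a\<close> is the vector of complex partial derivatives.\<close>

definition holomorphic_several :: "(complex^'d \<Rightarrow> complex) \<Rightarrow> (complex^'d) set \<Rightarrow> bool"
  where "holomorphic_several f S \<longleftrightarrow>
    (\<forall>z\<in>S. \<exists>a :: complex^'d. (f has_derivative (\<lambda>v. \<Sum>i\<in>UNIV. a $ i * v $ i)) (at z within S))"

definition holomorphic_map :: "(complex^'d \<Rightarrow> complex^'m) \<Rightarrow> (complex^'d) set \<Rightarrow> bool"
  where "holomorphic_map F S \<longleftrightarrow> (\<forall>j. holomorphic_several (\<lambda>z. F z $ j) S)"

definition ball_automorphism :: "(complex^'d \<Rightarrow> complex^'d) \<Rightarrow> bool"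
  where "ball_automorphism b \<longleftrightarrow> bij_betw b (ball 0 1) (ball 0 1) \<and>
    holomorphic_map b (ball 0 1) \<and> holomorphic_map (inv_into (ball 0 1) b) (ball 0 1)"

text \<open>On the ball \<open>1 - \<langle>z,w\<rangle>\<close> has positive real part, so the principal branch of the power used by
  \<open>powr\<close> is the holomorphic one.\<close>

definition s_kernel :: "real \<Rightarrow> complex^'d \<Rightarrow> complex^'d \<Rightarrow> complex"
  where "s_kernel \<beta> z w = (1 - hprod z w) powr (- of_real \<beta>)"

text \<open>A Hilbert function space is determined by its kernel, inner product included, so the following
  predicates single out \<open>(H, ip)\<close> up to the irrelevant values of \<open>ip\<close> off \<open>H\<close>.\<close>

definition is_H_beta ::
    "real \<Rightarrow> (complex^'d \<Rightarrow> complex) set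
      \<Rightarrow> ((complex^'d \<Rightarrow> complex) \<Rightarrow> (complex^'d \<Rightarrow> complex) \<Rightarrow> complex) \<Rightarrow> bool"
  where "is_H_beta \<beta> H ip \<longleftrightarrow> hilbert_function_space (ball 0 1) H ip (s_kernel \<beta>) \<and>
    (\<forall>f\<in>H. holomorphic_several f (ball 0 1))"

definition is_H_beta_b ::
    "real \<Rightarrow> (complex^'d \<Rightarrow> complex^'d) \<Rightarrow> (complex^'d \<Rightarrow> complex) set
      \<Rightarrow> ((complex^'d \<Rightarrow> complex) \<Rightarrow> (complex^'d \<Rightarrow> complex) \<Rightarrow> complex) \<Rightarrow> bool"
  where "is_H_beta_b \<beta> b H ip \<longleftrightarrow>
    hilbert_function_space (ball 0 1) H ip (\<lambda>z w. s_kernel \<beta> z w * (1 - hprod (b z) (b w)))"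

end

theory Submission
  imports Defs "HOL-Complex_Analysis.Conformal_Mappings"
begin

text \<open>
  With \<open>a = b\<^sup>-\<^sup>1(0)\<close> one has
  \<open>1 - \<langle>b(z), b(w)\<rangle> = (1 - \<parallel>a\<parallel>\<^sup>2) (1 - \<langle>z, w\<rangle>) / ((1 - \<langle>z, a\<rangle>) (1 - \<langle>a, w\<rangle>))\<close>,
  because \<open>b\<close> composed with the Moebius involution exchanging \<open>0\<close> and \<open>a\<close> is unitary. Hence the
  kernel of \<open>H\<^sub>\<beta>(b)\<close> is \<open>g(z) g(w)\<^sup>* (1 - \<langle>z, w\<rangle>)\<^sup>1\<^sup>-\<^sup>\<beta>\<close>, where \<open>g\<close> is a bounded multiplier of
  \<open>H\<^sub>\<beta>\<close>. The coefficients of \<open>(1 - t)\<^sup>1\<^sup>-\<^sup>\<beta>\<close> and \<open>(1 - t)\<^sup>-\<^sup>\<beta>\<close> have ratio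
  \<open>(\<beta> - 1) / (\<beta> - 1 + n)\<close>, which tends to \<open>0\<close>; so truncation of the power series approximates the
  embedding by operators of finite rank. All estimates are made on finite combinations of kernel
  functions, that is, on the quadratic forms of the kernels.
\<close>

section \<open>Reproducing kernels and total boundedness\<close>

text \<open>The two spaces are given only by their kernels, so neither an orthonormal basis nor a
  multiplication operator is at hand. What can be computed is the norm of a finite combination of
  kernel functions, a quadratic form in its coefficients \<open>y\<close>. The adjoint of
  multiplication by \<open>g\<close> multiplies the kernel function at \<open>w\<close> by
  \<open>cnj (g w)\<close>, so the multiplier appears as the map \<open>T y = cnj g * y\<close> on
  coefficients. For one sequence of nonnegative forms \<open>h n\<close>, the squared norm of
  \<open>y\<close> for the kernel of \<open>b\<close> is \<open>\<Sum>n. c' n * h n (T y)\<close>,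
  and the squared norm of \<open>T y\<close> for \<open>s_kernel \<beta>\<close> is
  \<open>\<Sum>n. c n * h n (T y)\<close>. All comparisons are thus termwise:
  \<open>c' n \<le> c n\<close> gives the inclusion, and \<open>c' n / c n\<close> tending to 0
  gives compactness. Estimates on forms turn back into statements on functions because a function on
  the ball belongs to the space exactly when its pairing with \<open>y\<close> is bounded by a
  multiple of the norm of the combination.\<close>

definition fin_coeffs :: "'a set \<Rightarrow> ('a \<Rightarrow> complex) set"
  where "fin_coeffs X = {y. finite {w. y w \<noteq> 0} \<and> {w. y w \<noteq> 0} \<subseteq> X}"

text \<open>This is the inner product of \<open>F\<close> with the combination of kernel functions
  with coefficients \<open>y\<close>, written so that it makes sense before \<open>F\<close> is
  known to lie in the space; hence the conjugate on \<open>y\<close>.\<close>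

definition pairing :: "('a \<Rightarrow> complex) \<Rightarrow> ('a \<Rightarrow> complex) \<Rightarrow> complex"
  where "pairing F y = (\<Sum>w | y w \<noteq> 0. cnj (y w) * F w)"

lemma fin_coeffs_add: "y \<in> fin_coeffs X \<Longrightarrow> y' \<in> fin_coeffs X \<Longrightarrow> (\<lambda>w. y w + y' w) \<in> fin_coeffs X"
proof -
  assume "y \<in> fin_coeffs X" "y' \<in> fin_coeffs X"
  moreover have "{w. y w + y' w \<noteq> 0} \<subseteq> {w. y w \<noteq> 0} \<union> {w. y' w \<noteq> 0}"
    by auto
  ultimately show ?thesis
    unfolding fin_coeffs_def by (auto intro: finite_subset)
qed

lemma fin_coeffs_mult: "y \<in> fin_coeffs X \<Longrightarrow> (\<lambda>w. g w * y w) \<in> fin_coeffs X"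
  unfolding fin_coeffs_def by (auto intro: finite_subset[of _ "{w. y w \<noteq> 0}"])

lemma fin_coeffs_single: "w \<in> X \<Longrightarrow> (\<lambda>v. if v = w then t else 0) \<in> fin_coeffs X"
  unfolding fin_coeffs_def by (auto intro: finite_subset[of _ "{w}"])

lemma pairing_superset:
  assumes "finite S" "{w. y w \<noteq> 0} \<subseteq> S"
  shows "pairing F y = (\<Sum>w\<in>S. cnj (y w) * F w)"
  unfolding pairing_def using assms by (intro sum.mono_neutral_left) auto

lemma pairing_add:
  assumes "y \<in> fin_coeffs X" "y' \<in> fin_coeffs X"
  shows "pairing F (\<lambda>w. y w + y' w) = pairing F y + pairing F y'"
proof -
  define S where "S = {w. y w \<noteq> 0} \<union> {w. y' w \<noteq> 0}"
  have S: "finite S" using assms by (auto simp: S_def fin_coeffs_def)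
  have "{w. y w \<noteq> 0} \<subseteq> S" "{w. y' w \<noteq> 0} \<subseteq> S" "{w. y w + y' w \<noteq> 0} \<subseteq> S"
    by (auto simp: S_def)
  then show ?thesis
    by (simp add: pairing_superset[OF S] sum.distrib algebra_simps)
qed

lemma pairing_mult:
  assumes "y \<in> fin_coeffs X"
  shows "pairing F (\<lambda>w. g w * y w) = pairing (\<lambda>w. cnj (g w) * F w) y"
  using assms pairing_superset[of "{w. y w \<noteq> 0}" "\<lambda>w. g w * y w" F]
  by (auto simp: pairing_def fin_coeffs_def mult_ac)

lemma pairing_scale_left: "pairing (\<lambda>w. t * F w) y = t * pairing F y"
  by (simp add: pairing_def sum_distrib_left mult_ac)

lemma pairing_sum_left: "pairing (\<lambda>w. \<Sum>i\<in>I. F i w) y = (\<Sum>i\<in>I. pairing (F i) y)"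
  unfolding pairing_def sum_distrib_left by (rule sum.swap)

lemma pairing_single: "pairing F (\<lambda>v. if v = w then t else 0) = cnj t * F w"
proof -
  have "{v. (if v = w then t else 0) \<noteq> 0} \<subseteq> {w}" by auto
  from pairing_superset[OF _ this, of F] show ?thesis by simp
qed

section \<open>Inner product geometry: Cauchy-Schwarz, parallelogram law, continuity\<close>

context pre_hilbert_function_space
begin

lemma ip_diff_left: "f \<in> H \<Longrightarrow> g \<in> H \<Longrightarrow> h \<in> H \<Longrightarrow> ip (\<lambda>x. f x - g x) h = ip f h - ip g h"
  using ip_add_left[OF diff_mem[of f g] _, of g h] by simp

lemma ip_diff_right: "f \<in> H \<Longrightarrow> g \<in> H \<Longrightarrow> h \<in> H \<Longrightarrow> ip h (\<lambda>x. f x - g x) = ip h f - ip h g"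
  using ip_add_right[OF diff_mem[of f g] _, of g h] by simp

lemma ip_zero_right: "f \<in> H \<Longrightarrow> ip f (\<lambda>_. 0) = 0"
  using ip_scale_right[of "\<lambda>_. 0" f 0] zero_mem by simp

lemma ip_self: "f \<in> H \<Longrightarrow> ip f f = of_real ((ip_norm ip f)\<^sup>2)"
  using ip_commute[of f f] ip_nonneg[of f] by (auto simp: ip_norm_def complex_eq_iff)

lemma ip_norm_nonneg: "f \<in> H \<Longrightarrow> 0 \<le> ip_norm ip f"
  using ip_nonneg by (simp add: ip_norm_def)

lemma ip_norm_scale:
  assumes "f \<in> H"
  shows "ip_norm ip (\<lambda>x. t * f x) = cmod t * ip_norm ip f"
proof -
  have "ip (\<lambda>x. t * f x) (\<lambda>x. t * f x) = (t * cnj t) * ip f f"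
    using assms by (simp add: ip_scale_left ip_scale_right scale_mem)
  also have "\<dots> = of_real ((cmod t)\<^sup>2 * (ip_norm ip f)\<^sup>2)"
    unfolding complex_norm_square[symmetric] ip_self[OF assms] by simp
  also have "\<dots> = of_real ((cmod t * ip_norm ip f)\<^sup>2)"
    by (simp add: power_mult_distrib)
  finally show ?thesis
    using ip_norm_nonneg[OF assms] by (simp add: ip_norm_def[of ip "\<lambda>x. t * f x"])
qed

lemma norm_ip_le:
  assumes "f \<in> H" "g \<in> H"
  shows "cmod (ip f g) \<le> ip_norm ip f * ip_norm ip g"
proof (cases "ip f g = 0")
  case True
  then show ?thesis using ip_norm_nonneg assms by simp
next
  case False
  \<comment> \<open>A unimodular factor rotates the inner product onto the positive real axis, where
    the bound for real parts applies.\<close>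
  define u where "u = cnj (ip f g) / of_real (cmod (ip f g))"
  have "u * ip f g = of_real ((cmod (ip f g))\<^sup>2) / of_real (cmod (ip f g))"
    unfolding complex_norm_square by (simp add: u_def)
  then have u: "cmod u = 1" "u * ip f g = of_real (cmod (ip f g))"
    using False by (auto simp: u_def norm_divide power2_eq_square)
  have "cmod (ip f g) = Re (ip (\<lambda>x. u * f x) g)"
    using u assms by (simp add: ip_scale_left)
  also have "\<dots> \<le> ip_norm ip f * ip_norm ip g"
    using Re_ip_le[OF scale_mem[OF assms(1), of u] assms(2)] u ip_norm_scale[OF assms(1), of u] by simp
  finally show ?thesis .
qed

text \<open>Stated with the midpoint because it is applied to a minimising sequence, whose midpoints
  are again competitors.\<close>

lemma ip_norm_parallelogram:
  assumes "f \<in> H" "g \<in> H"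
  shows "(ip_norm ip (\<lambda>x. f x - g x))\<^sup>2 = 2 * (ip_norm ip f)\<^sup>2 + 2 * (ip_norm ip g)\<^sup>2
    - 4 * (ip_norm ip (\<lambda>x. (1/2) * (f x + g x)))\<^sup>2"
proof -
  have "(\<lambda>x. f x - g x) = (\<lambda>x. f x + of_real (-1) * g x)" by auto
  then have 1: "(ip_norm ip (\<lambda>x. f x - g x))\<^sup>2 = Re (ip f f) - 2 * Re (ip f g) + Re (ip g g)"
    using ip_expand[OF assms, of "-1"] ip_nonneg[OF diff_mem[OF assms]]
    by (simp add: ip_norm_def)
  have "(ip_norm ip (\<lambda>x. f x + g x))\<^sup>2 = Re (ip f f) + 2 * Re (ip f g) + Re (ip g g)"
    using ip_expand[OF assms, of "1"] ip_nonneg[OF add_mem[OF assms]]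
    by (simp add: ip_norm_def)
  moreover have "(ip_norm ip (\<lambda>x. (1/2) * (f x + g x)))\<^sup>2 = (ip_norm ip (\<lambda>x. f x + g x))\<^sup>2 / 4"
    unfolding ip_norm_scale[OF add_mem[OF assms]] by (simp add: power_divide)
  ultimately show ?thesis
    using 1 ip_nonneg[OF assms(1)] ip_nonneg[OF assms(2)] by (simp add: ip_norm_def)
qed

lemma sum_mem: "finite S \<Longrightarrow> (\<And>i. i \<in> S \<Longrightarrow> f i \<in> H) \<Longrightarrow> (\<lambda>x. \<Sum>i\<in>S. f i x) \<in> H"
  by (induction S rule: finite_induct) (auto simp: zero_mem add_mem)

lemma ip_sum_right:
  "finite S \<Longrightarrow> (\<And>i. i \<in> S \<Longrightarrow> f i \<in> H) \<Longrightarrow> h \<in> H \<Longrightarrow>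
    ip h (\<lambda>x. \<Sum>i\<in>S. f i x) = (\<Sum>i\<in>S. ip h (f i))"
  by (induction S rule: finite_induct) (auto simp: ip_zero_right ip_add_right sum_mem)

lemma tendsto_ip_norm_diff_imp:
  assumes "\<And>n. u n \<in> H" "f \<in> H" "(\<lambda>n. ip_norm ip (\<lambda>x. u n x - f x)) \<longlonglongrightarrow> 0"
  shows "g \<in> H \<Longrightarrow> (\<lambda>n. ip (u n) g) \<longlonglongrightarrow> ip f g"
    and "g \<in> H \<Longrightarrow> (\<lambda>n. ip g (u n)) \<longlonglongrightarrow> ip g f"
    and "(\<lambda>n. ip_norm ip (u n)) \<longlonglongrightarrow> ip_norm ip f"
proof -
  have 0: "(\<lambda>n. ip_norm ip (\<lambda>x. u n x - f x) * ip_norm ip g) \<longlonglongrightarrow> 0" for g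
    using tendsto_mult_left_zero[OF assms(3)] .
  show 1: "(\<lambda>n. ip (u n) g) \<longlonglongrightarrow> ip f g" if "g \<in> H" for g
  proof -
    have "(\<lambda>n. ip (u n) g - ip f g) \<longlonglongrightarrow> 0"
      by (rule Lim_null_comparison[OF _ 0[of g]])
        (use assms that norm_ip_le[OF diff_mem] in \<open>auto simp: ip_diff_left[symmetric]\<close>)
    then show ?thesis by (rule LIM_zero_cancel)
  qed
  show "(\<lambda>n. ip g (u n)) \<longlonglongrightarrow> ip g f" if "g \<in> H" for g
    using tendsto_cnj[OF 1[OF that]] that assms by (simp add: ip_commute[symmetric])
  show "(\<lambda>n. ip_norm ip (u n)) \<longlonglongrightarrow> ip_norm ip f"
  proof -
    have "\<bar>ip_norm ip (u n) - ip_norm ip f\<bar> \<le> ip_norm ip (\<lambda>x. u n x - f x)" for n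
    proof -
      have "ip_norm ip (u n) \<le> ip_norm ip (\<lambda>x. u n x - f x) + ip_norm ip f"
        using ip_norm_add[OF diff_mem[OF assms(1,2)] assms(2), of n] by simp
      moreover have "ip_norm ip f \<le> ip_norm ip (\<lambda>x. u n x - f x) + ip_norm ip (u n)"
        using ip_norm_add[OF scale_mem[OF diff_mem[OF assms(1)[of n] assms(2)], of "-1"] assms(1)[of n]]
          ip_norm_scale[OF diff_mem[OF assms(1)[of n] assms(2)], of "-1"] by simp
      ultimately show ?thesis by linarith
    qed
    then have "(\<lambda>n. ip_norm ip (u n) - ip_norm ip f) \<longlonglongrightarrow> 0"
      by (intro Lim_null_comparison[OF _ assms(3)]) auto
    then show ?thesis by (rule LIM_zero_cancel)
  qed
qed

end

section \<open>The span of the kernel functions\<close>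

context hilbert_function_space
begin

definition kernel_at :: "'a \<Rightarrow> 'a \<Rightarrow> complex"
  where "kernel_at w = (\<lambda>z. if z \<in> X then K z w else 0)"

definition comb :: "('a \<Rightarrow> complex) \<Rightarrow> 'a \<Rightarrow> complex"
  where "comb y = (\<lambda>z. \<Sum>w | y w \<noteq> 0. y w * kernel_at w z)"

lemma kernel_at_mem: "w \<in> X \<Longrightarrow> kernel_at w \<in> H"
  and ip_kernel_at: "f \<in> H \<Longrightarrow> w \<in> X \<Longrightarrow> ip f (kernel_at w) = f w"
  using kernel unfolding is_reproducing_kernel_def kernel_at_def by auto

lemma comb_superset:
  assumes "finite S" "{w. y w \<noteq> 0} \<subseteq> S"
  shows "comb y = (\<lambda>z. \<Sum>w\<in>S. y w * kernel_at w z)"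
  unfolding comb_def using assms by (intro ext sum.mono_neutral_left) auto

lemma comb_add:
  assumes "y \<in> fin_coeffs X" "y' \<in> fin_coeffs X"
  shows "comb (\<lambda>w. y w + y' w) = (\<lambda>z. comb y z + comb y' z)"
proof -
  define S where "S = {w. y w \<noteq> 0} \<union> {w. y' w \<noteq> 0}"
  have S: "finite S" using assms by (auto simp: S_def fin_coeffs_def)
  have "{w. y w \<noteq> 0} \<subseteq> S" "{w. y' w \<noteq> 0} \<subseteq> S" "{w. y w + y' w \<noteq> 0} \<subseteq> S"
    by (auto simp: S_def)
  then show ?thesis
    by (simp add: comb_superset[OF S] sum.distrib algebra_simps)
qed

lemma comb_scale:
  assumes "y \<in> fin_coeffs X"
  shows "comb (\<lambda>w. t * y w) = (\<lambda>z. t * comb y z)"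
  using assms comb_superset[of "{w. y w \<noteq> 0}" "\<lambda>w. t * y w"]
  by (auto simp: comb_def fin_coeffs_def sum_distrib_left mult_ac)

lemma comb_mem:
  assumes "y \<in> fin_coeffs X"
  shows "comb y \<in> H"
  unfolding comb_def
proof (rule sum_mem)
  show "finite {w. y w \<noteq> 0}" using assms by (simp add: fin_coeffs_def)
  fix w assume "w \<in> {w. y w \<noteq> 0}"
  then have "w \<in> X" using assms by (auto simp: fin_coeffs_def)
  then show "(\<lambda>z. y w * kernel_at w z) \<in> H" by (intro scale_mem kernel_at_mem)
qed

lemma comb_single: "comb (\<lambda>v. if v = w then t else 0) = (\<lambda>z. t * kernel_at w z)"
proof -
  have "{v. (if v = w then t else 0) \<noteq> 0} \<subseteq> {w}" by auto
  from comb_superset[OF _ this] show ?thesis by simp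
qed

lemma ip_comb:
  assumes "y \<in> fin_coeffs X" "f \<in> H"
  shows "ip f (comb y) = pairing f y"
proof -
  have k: "kernel_at w \<in> H" if "w \<in> {w. y w \<noteq> 0}" for w
    using assms that kernel_at_mem by (auto simp: fin_coeffs_def)
  have "ip f (comb y) = (\<Sum>w | y w \<noteq> 0. ip f (\<lambda>z. y w * kernel_at w z))"
    unfolding comb_def
    by (rule ip_sum_right) (use assms k scale_mem in \<open>simp_all add: fin_coeffs_def\<close>)
  also have "\<dots> = pairing f y"
    unfolding pairing_def using assms
    by (intro sum.cong) (auto simp: fin_coeffs_def subset_iff ip_scale_right kernel_at_mem ip_kernel_at)
  finally show ?thesis .
qed

text \<open>Riesz representation on the span of the kernel functions: \<open>F\<close> is found as the limit of a
  sequence minimising \<open>\<parallel>h\<parallel>\<^sup>2 - 2 Re \<langle>F, h\<rangle>\<close> over that span, where \<open>\<langle>F, h\<rangle>\<close> stands for the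
  pairing.\<close>

lemma mem_of_bounded_pairing:
  assumes F0: "\<And>x. x \<notin> X \<Longrightarrow> F x = 0"
    and bd: "\<And>y. y \<in> fin_coeffs X \<Longrightarrow> cmod (pairing F y) \<le> c * ip_norm ip (comb y)"
  shows "F \<in> H" and "\<exists>y. (\<forall>n. y n \<in> fin_coeffs X) \<and> (\<lambda>n. ip_norm ip (\<lambda>x. comb (y n) x - F x)) \<longlonglongrightarrow> 0"
proof -
  define E where "E y = (ip_norm ip (comb y))\<^sup>2 - 2 * Re (pairing F y)" for y
  define m where "m = Inf (E ` fin_coeffs X)"
  have zero: "(\<lambda>_. 0) \<in> fin_coeffs X" by (simp add: fin_coeffs_def)
  \<comment> \<open>Completing the square: with \<open>N\<close> the norm of \<open>comb y\<close>,
    \<open>E y\<close> is at least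
    \<open>N\<^sup>2 - 2 * c * N = (N - c)\<^sup>2 - c\<^sup>2\<close>.\<close>
  have "- c\<^sup>2 \<le> E y" if "y \<in> fin_coeffs X" for y
  proof -
    have "Re (pairing F y) \<le> c * ip_norm ip (comb y)"
      using bd[OF that] complex_Re_le_cmod order_trans by blast
    moreover have "0 \<le> (ip_norm ip (comb y) - c)\<^sup>2" by simp
    ultimately show ?thesis unfolding E_def power2_diff by (simp add: mult_ac)
  qed
  then have bdd: "bdd_below (E ` fin_coeffs X)" by (auto simp: bdd_below_def)
  have m_le: "m \<le> E y" if "y \<in> fin_coeffs X" for y
    unfolding m_def using bdd that by (auto intro: cInf_lower)
  have "\<exists>y\<in>fin_coeffs X. E y < m + inverse (real (Suc n))" for n
    using cInf_lessD[of "E ` fin_coeffs X" "m + inverse (real (Suc n))"] zero unfolding m_def by auto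
  then obtain y where y: "\<And>n. y n \<in> fin_coeffs X" "\<And>n. E (y n) < m + inverse (real (Suc n))"
    by metis
  have Em: "(\<lambda>n. E (y n)) \<longlonglongrightarrow> m"
    by (rule tendsto_sandwich[OF _ _ tendsto_const LIMSEQ_inverse_real_of_nat_add[of m]])
      (use y m_le in \<open>auto intro!: always_eventually less_imp_le simp del: of_nat_Suc\<close>)
  let ?u = "\<lambda>n. comb (y n)"
  have u: "?u n \<in> H" for n using comb_mem y by blast
  \<comment> \<open>The pairing is additive, so the parallelogram law holds for \<open>E\<close>
    itself with the midpoint \<open>v\<close>; since \<open>E v \<ge> m\<close>, two near-minimisers
    are close.\<close>
  have par: "(ip_norm ip (\<lambda>x. ?u n x - ?u k x))\<^sup>2 \<le> 2 * inverse (real (Suc n)) + 2 * inverse (real (Suc k))"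
    for n k
  proof -
    define v where "v = (\<lambda>w. (1/2) * (y n w + y k w))"
    have v: "v \<in> fin_coeffs X" unfolding v_def by (intro fin_coeffs_mult fin_coeffs_add y)
    have "comb v = (\<lambda>x. (1/2) * (?u n x + ?u k x))"
      unfolding v_def by (simp only: comb_scale[OF fin_coeffs_add[OF y(1) y(1)]] comb_add[OF y(1) y(1)])
    moreover have "pairing F v = (1/2) * (pairing F (y n) + pairing F (y k))"
      unfolding v_def
      by (simp only: pairing_mult[OF fin_coeffs_add[OF y(1) y(1)]] pairing_add[OF y(1) y(1)] pairing_scale_left) simp
    ultimately have "(ip_norm ip (\<lambda>x. ?u n x - ?u k x))\<^sup>2 = 2 * E (y n) + 2 * E (y k) - 4 * E v"
      using ip_norm_parallelogram[OF u u, of n k] by (simp add: E_def algebra_simps)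
    also have "\<dots> \<le> 2 * inverse (real (Suc n)) + 2 * inverse (real (Suc k))"
      using m_le[OF v] y(2)[of n] y(2)[of k] by linarith
    finally show ?thesis .
  qed
  have "MCauchy ?u"
    unfolding MCauchy_def
  proof (intro conjI allI impI)
    show "range ?u \<subseteq> H" using u by auto
    fix e :: real assume e: "0 < e"
    obtain N where N: "inverse (real (Suc N)) < e\<^sup>2 / 4"
      using reals_Archimedean[of "e\<^sup>2 / 4"] e by auto
    have "ip_dist H ip (?u n) (?u k) < e" if "N \<le> n" "N \<le> k" for n k
    proof -
      have "inverse (real (Suc n)) \<le> inverse (real (Suc N))" "inverse (real (Suc k)) \<le> inverse (real (Suc N))"
        using that by (auto intro!: le_imp_inverse_le)
      then have "(ip_norm ip (\<lambda>x. ?u n x - ?u k x))\<^sup>2 < e\<^sup>2"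
        using par[of n k] N by linarith
      then show ?thesis
        using u e by (simp add: ip_dist_def power_less_imp_less_base)
    qed
    then show "\<exists>N. \<forall>n n'. N \<le> n \<longrightarrow> N \<le> n' \<longrightarrow> ip_dist H ip (?u n) (?u n') < e" by blast
  qed
  then obtain f where f: "limitin mtopology ?u f sequentially"
    using complete unfolding mcomplete_def by blast
  then have fH: "f \<in> H" by (simp add: limitin_metric)
  have lim: "(\<lambda>n. ip_norm ip (\<lambda>x. ?u n x - f x)) \<longlonglongrightarrow> 0"
  proof -
    have "(\<lambda>n. ip_dist H ip (?u n) f) \<longlonglongrightarrow> 0"
      using f unfolding limitin_metric_dist_null by blast
    then show ?thesis using u fH by (simp add: ip_dist_def)
  qed
  have "f w = F w" for w
  proof (cases "w \<in> X")
    case True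
    define D where "D = f w - F w"
    define k where "k = (ip_norm ip (kernel_at w))\<^sup>2"
    \<comment> \<open>First variation: adding \<open>t\<close> times the kernel function at
      \<open>w\<close> to the minimising sequence cannot bring the limit of \<open>E\<close> below
      \<open>m\<close>.\<close>
    have "0 \<le> 2 * Re (cnj t * D) + (cmod t)\<^sup>2 * k" for t
    proof -
      let ?s = "\<lambda>v. if v = w then t else 0"
      have kt: "(\<lambda>z. t * kernel_at w z) \<in> H" using True by (simp add: scale_mem kernel_at_mem)
      have "E (\<lambda>v. y n v + ?s v) = E (y n) + 2 * Re (cnj t * (?u n w - F w)) + (cmod t)\<^sup>2 * k" for n
      proof -
        have "comb (\<lambda>v. y n v + ?s v) = (\<lambda>z. ?u n z + of_real 1 * (t * kernel_at w z))"
          using comb_add[OF y(1) fin_coeffs_single[OF True, of t]] comb_single by simp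
        then have "(ip_norm ip (comb (\<lambda>v. y n v + ?s v)))\<^sup>2
            = Re (ip (?u n) (?u n)) + 2 * Re (ip (?u n) (\<lambda>z. t * kernel_at w z))
              + Re (ip (\<lambda>z. t * kernel_at w z) (\<lambda>z. t * kernel_at w z))"
          using ip_expand[OF u kt, of n 1] ip_nonneg[OF add_mem[OF u kt], of n]
          by (simp add: ip_norm_def)
        also have "\<dots> = (ip_norm ip (?u n))\<^sup>2 + 2 * Re (cnj t * ?u n w) + (cmod t)\<^sup>2 * k"
          using True u ip_self[OF kt] ip_norm_scale[OF kernel_at_mem[OF True], of t]
            ip_nonneg[OF u, of n]
          by (simp add: ip_scale_right kernel_at_mem ip_kernel_at k_def ip_norm_def[of ip "?u n"]
              power_mult_distrib)
        finally show ?thesis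
          using pairing_add[OF y(1) fin_coeffs_single[OF True, of t]] pairing_single[of F w t]
          by (simp add: E_def algebra_simps)
      qed
      then have "m \<le> E (y n) + 2 * Re (cnj t * (?u n w - F w)) + (cmod t)\<^sup>2 * k" for n
        using m_le[OF fin_coeffs_add[OF y(1) fin_coeffs_single[OF True, of t]], of n] by simp
      moreover have "(\<lambda>n. ?u n w) \<longlonglongrightarrow> f w"
        using tendsto_ip_norm_diff_imp(1)[OF u fH lim kernel_at_mem[OF True]] True u fH
        by (simp add: ip_kernel_at)
      then have "(\<lambda>n. E (y n) + 2 * Re (cnj t * (?u n w - F w)) + (cmod t)\<^sup>2 * k)
          \<longlonglongrightarrow> m + 2 * Re (cnj t * D) + (cmod t)\<^sup>2 * k"
        unfolding D_def by (intro tendsto_intros Em)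
      ultimately have "m \<le> m + 2 * Re (cnj t * D) + (cmod t)\<^sup>2 * k"
        by (intro LIMSEQ_le_const) auto
      then show ?thesis by simp
    qed
    note nonneg = this
    \<comment> \<open>With \<open>t = - s * D\<close> the quadratic term is at most half the size of
      the linear one, which forces \<open>D = 0\<close>; the summand 1 covers
      \<open>k = 0\<close>.\<close>
    define s where "s = 1 / (k + 1)"
    have k: "k \<ge> 0" by (simp add: k_def)
    then have s: "s > 0" "s * k \<le> 1" by (auto simp: s_def field_simps)
    have "0 \<le> 2 * Re (of_real (- s) * (D * cnj D)) + (cmod (of_real (- s) * D))\<^sup>2 * k"
      using nonneg[of "of_real (- s) * D"] by (simp add: mult_ac)
    also have "\<dots> = - 2 * s * (cmod D)\<^sup>2 + s * (cmod D)\<^sup>2 * (s * k)"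
      unfolding complex_norm_square[symmetric] norm_mult norm_of_real power_mult_distrib
      by (simp add: power2_eq_square)
    also have "\<dots> \<le> - 2 * s * (cmod D)\<^sup>2 + s * (cmod D)\<^sup>2 * 1"
      using s by (intro add_left_mono mult_left_mono) auto
    finally have "(cmod D)\<^sup>2 \<le> 0"
      using s by (simp add: mult_le_0_iff)
    then show ?thesis by (simp add: D_def)
  qed (use F0 outside fH in auto)
  then have fF: "f = F" by blast
  show "F \<in> H" using fH fF by simp
  show "\<exists>y. (\<forall>n. y n \<in> fin_coeffs X) \<and> (\<lambda>n. ip_norm ip (\<lambda>x. comb (y n) x - F x)) \<longlonglongrightarrow> 0"
    by (rule exI[of _ y], rule conjI, rule allI, rule y(1), rule lim[unfolded fF])
qed

end

section \<open>Finite nets and relatively compact sets\<close>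

lemma floor_divide_eq_imp_abs_diff_le:
  fixes x y \<eta> :: real
  assumes "\<eta> > 0" "\<lfloor>x / \<eta>\<rfloor> = \<lfloor>y / \<eta>\<rfloor>"
  shows "\<bar>x - y\<bar> \<le> \<eta>"
proof -
  have "\<bar>x / \<eta> - y / \<eta>\<bar> \<le> 1" using assms(2) by linarith
  then have "\<bar>x - y\<bar> / \<eta> \<le> 1" using assms(1) by (simp add: diff_divide_distrib[symmetric])
  then show ?thesis using assms(1) by simp
qed

text \<open>Real and imaginary parts are rounded to a grid of mesh \<open>\<eta>\<close>. Bounded
  coordinates meet finitely many cells, and one element of \<open>B\<close> is kept per occupied
  cell. The factor 2 adds the two parts.\<close>

lemma finite_net_of_bounded_coordinates:
  fixes c :: "'i \<Rightarrow> 'b \<Rightarrow> complex" and R :: "'i \<Rightarrow> real"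
  assumes J: "finite J" and R: "\<And>i f. f \<in> B \<Longrightarrow> cmod (c i f) \<le> R i" and \<eta>: "\<eta> > 0"
  obtains N where "finite N" "N \<subseteq> B"
    "\<And>f. f \<in> B \<Longrightarrow> \<exists>g\<in>N. \<forall>i\<in>J. (cmod (c i f - c i g))\<^sup>2 \<le> 2 * \<eta>\<^sup>2"
proof -
  define G where "G f = (\<lambda>i\<in>J. (\<lfloor>Re (c i f) / \<eta>\<rfloor>, \<lfloor>Im (c i f) / \<eta>\<rfloor>))" for f
  define D where "D i = {\<lfloor>- (R i / \<eta>)\<rfloor>..\<lfloor>R i / \<eta>\<rfloor>}" for i
  have in_D: "\<lfloor>x / \<eta>\<rfloor> \<in> D i" if "\<bar>x\<bar> \<le> R i" for x i
  proof -
    have "x / \<eta> \<le> R i / \<eta>" "- (R i / \<eta>) \<le> x / \<eta>"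
      using that \<eta> by (auto simp: divide_right_mono minus_divide_left simp del: minus_divide_left[symmetric])
    then show ?thesis by (auto simp: D_def floor_mono)
  qed
  have "G ` B \<subseteq> (\<Pi>\<^sub>E i\<in>J. D i \<times> D i)"
  proof (intro image_subsetI)
    fix f assume "f \<in> B"
    then have "\<bar>Re (c i f)\<bar> \<le> R i" "\<bar>Im (c i f)\<bar> \<le> R i" for i
      using R[of f i] abs_Re_le_cmod[of "c i f"] abs_Im_le_cmod[of "c i f"] by linarith+
    then show "G f \<in> (\<Pi>\<^sub>E i\<in>J. D i \<times> D i)"
      unfolding G_def using in_D by auto
  qed
  moreover have "finite (\<Pi>\<^sub>E i\<in>J. D i \<times> D i)"
    using J by (intro finite_PiE) (auto simp: D_def)
  ultimately have "finite (G ` B)" by (rule finite_subset)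
  then obtain N where N: "N \<subseteq> B" "finite N" "G ` B = G ` N"
    using finite_subset_image[OF _ order_refl] by meson
  have "\<exists>g\<in>N. \<forall>i\<in>J. (cmod (c i f - c i g))\<^sup>2 \<le> 2 * \<eta>\<^sup>2" if "f \<in> B" for f
  proof -
    have "G f \<in> G ` N" using that N(3) by auto
    then obtain g where g: "g \<in> N" "G f = G g" by auto
    have "(cmod (c i f - c i g))\<^sup>2 \<le> 2 * \<eta>\<^sup>2" if "i \<in> J" for i
    proof -
      have "G f i = G g i" using g by simp
      then have "\<bar>Re (c i f) - Re (c i g)\<bar> \<le> \<eta>" "\<bar>Im (c i f) - Im (c i g)\<bar> \<le> \<eta>"
        using that floor_divide_eq_imp_abs_diff_le[OF \<eta>] by (simp_all add: G_def)
      then have "(Re (c i f) - Re (c i g))\<^sup>2 \<le> \<eta>\<^sup>2" "(Im (c i f) - Im (c i g))\<^sup>2 \<le> \<eta>\<^sup>2"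
        using \<eta> by (auto simp: abs_le_square_iff[symmetric])
      then show ?thesis by (simp add: cmod_power2)
    qed
    then show ?thesis using g by blast
  qed
  then show ?thesis using that N by blast
qed

context hilbert_function_space
begin

text \<open>By Cauchy-Schwarz \<open>F\<close> satisfies the hypothesis of the Riesz argument, whose
  minimising sequence then converges to \<open>F\<close> itself.\<close>

lemma comb_dense:
  assumes "F \<in> H"
  obtains y where "\<And>n. y n \<in> fin_coeffs X" "(\<lambda>n. ip_norm ip (\<lambda>x. comb (y n) x - F x)) \<longlonglongrightarrow> 0"
proof -
  have "cmod (pairing F y) \<le> ip_norm ip F * ip_norm ip (comb y)" if "y \<in> fin_coeffs X" for y
    using norm_ip_le[OF assms comb_mem[OF that]] ip_comb[OF that assms] by simp
  from mem_of_bounded_pairing(2)[OF outside[OF assms] this] show ?thesis using that by blast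
qed

text \<open>Testing the bound on combinations that converge to \<open>F\<close> gives
  \<open>\<parallel>F\<parallel>\<^sup>2 \<le> c * \<parallel>F\<parallel>\<close> in the
  limit.\<close>

lemma norm_le_of_bounded_pairing:
  assumes F: "F \<in> H"
    and bd: "\<And>y. y \<in> fin_coeffs X \<Longrightarrow> cmod (pairing F y) \<le> c * ip_norm ip (comb y)" and c: "c \<ge> 0"
  shows "ip_norm ip F \<le> c"
proof -
  obtain y where y: "\<And>n. y n \<in> fin_coeffs X" "(\<lambda>n. ip_norm ip (\<lambda>x. comb (y n) x - F x)) \<longlonglongrightarrow> 0"
    using comb_dense[OF F] by blast
  note lim = tendsto_ip_norm_diff_imp[OF comb_mem[OF y(1)] F y(2)]
  have "cmod (ip F F) \<le> c * ip_norm ip F"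
    by (rule LIMSEQ_le[OF tendsto_norm[OF lim(2)[OF F]] tendsto_mult_left[OF lim(3)]])
      (use bd[OF y(1)] ip_comb[OF y(1) F] in auto)
  then have *: "ip_norm ip F * ip_norm ip F \<le> c * ip_norm ip F"
    using ip_self[OF F] by (simp add: power2_eq_square norm_mult)
  show ?thesis
  proof (cases "ip_norm ip F = 0")
    case False
    then have "ip_norm ip F > 0" using ip_norm_nonneg[OF F] by linarith
    then show ?thesis using * by simp
  qed (use c in simp)
qed

text \<open>\<open>approx\<close> says that the embedding is, up to \<open>\<epsilon>\<close>, an operator of finite rank: two elements of \<open>B\<close>
  whose inner products with all \<open>e i\<close> nearly agree are close.\<close>

lemma compact_closure_of_finite_rank_bounds:
  fixes e :: "'i \<Rightarrow> 'a \<Rightarrow> complex"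
  assumes B0: "\<And>f x. f \<in> B \<Longrightarrow> x \<notin> X \<Longrightarrow> f x = 0"
    and bd: "\<And>f y. f \<in> B \<Longrightarrow> y \<in> fin_coeffs X \<Longrightarrow> cmod (pairing f y) \<le> C * ip_norm ip (comb y)"
    and C: "C \<ge> 0"
    and e: "\<And>i. e i \<in> H"
    and approx: "\<And>\<epsilon>. \<epsilon> > 0 \<Longrightarrow> \<exists>J. finite J \<and> (\<forall>f\<in>B. \<forall>y\<in>fin_coeffs X.
      (cmod (pairing f y))\<^sup>2 \<le> \<epsilon> * (ip_norm ip (comb y))\<^sup>2 + (\<Sum>i\<in>J. (cmod (pairing (e i) y))\<^sup>2))"
  shows "compactin mtopology (mtopology closure_of B)"
proof -
  have BH: "f \<in> H" and norm_le: "ip_norm ip f \<le> C" if "f \<in> B" for f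
  proof -
    show "f \<in> H" by (rule mem_of_bounded_pairing(1)[of f C]) (use B0[OF that] bd[OF that] in auto)
    then show "ip_norm ip f \<le> C" using norm_le_of_bounded_pairing bd that C by blast
  qed
  have "mtotally_bounded B"
    unfolding mtotally_bounded_def
  proof (intro allI impI)
    fix \<delta> :: real assume \<delta>: "\<delta> > 0"
    \<comment> \<open>Differences of elements of \<open>B\<close> have norm at most
      \<open>2 * C\<close>, so the \<open>\<epsilon>\<close> term costs at most
      \<open>\<delta>^4 / 16\<close>; \<open>\<eta>\<close> below is chosen so that the finite sum
      costs as much. Together they stay below the square of \<open>\<delta>\<^sup>2 / 2\<close>. The
      summand 1 covers \<open>C = 0\<close>.\<close>
    define \<epsilon> where "\<epsilon> = \<delta>^4 / (16 * (4 * C\<^sup>2 + 1))"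
    have \<epsilon>: "\<epsilon> > 0" "\<epsilon> * (4 * C\<^sup>2) \<le> \<delta>^4 / 16"
    proof -
      have "4 * C\<^sup>2 + 1 > 0" by (simp add: add_nonneg_pos)
      then show "\<epsilon> > 0" "\<epsilon> * (4 * C\<^sup>2) \<le> \<delta>^4 / 16"
        using \<delta> by (auto simp: \<epsilon>_def field_simps)
    qed
    obtain J where J: "finite J" and "\<forall>f\<in>B. \<forall>y\<in>fin_coeffs X.
      (cmod (pairing f y))\<^sup>2 \<le> \<epsilon> * (ip_norm ip (comb y))\<^sup>2 + (\<Sum>i\<in>J. (cmod (pairing (e i) y))\<^sup>2)"
      using approx[OF \<epsilon>(1)] by blast
    then have Jy: "(cmod (ip f (comb y)))\<^sup>2 \<le> \<epsilon> * (ip_norm ip (comb y))\<^sup>2 + (\<Sum>i\<in>J. (cmod (ip (e i) (comb y)))\<^sup>2)"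
      if "f \<in> B" "y \<in> fin_coeffs X" for f y
      using that by (simp add: ip_comb BH e)
    \<comment> \<open>The test vector will be a difference of two elements of \<open>B\<close>,
      which need not be a finite combination; density extends the bound to it.\<close>
    have Jh: "(cmod (ip f h))\<^sup>2 \<le> \<epsilon> * (ip_norm ip h)\<^sup>2 + (\<Sum>i\<in>J. (cmod (ip (e i) h))\<^sup>2)"
      if f: "f \<in> B" and h: "h \<in> H" for f h
    proof -
      obtain y where y: "\<And>n. y n \<in> fin_coeffs X" "(\<lambda>n. ip_norm ip (\<lambda>x. comb (y n) x - h x)) \<longlonglongrightarrow> 0"
        using comb_dense[OF h] by blast
      note lim = tendsto_ip_norm_diff_imp[OF comb_mem[OF y(1)] h y(2)]
      show ?thesis
        by (rule LIMSEQ_le[of "\<lambda>n. (cmod (ip f (comb (y n))))\<^sup>2" _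
              "\<lambda>n. \<epsilon> * (ip_norm ip (comb (y n)))\<^sup>2 + (\<Sum>i\<in>J. (cmod (ip (e i) (comb (y n))))\<^sup>2)"])
          (use Jy[OF f y(1)] in \<open>auto intro!: tendsto_intros lim BH[OF f] e\<close>)
    qed
    define \<eta> where "\<eta> = sqrt (\<delta>^4 / (32 * (real (card J) + 1)))"
    have \<eta>: "\<eta> > 0" using \<delta> by (simp add: \<eta>_def)
    have \<eta>2: "real (card J) * (2 * \<eta>\<^sup>2) \<le> \<delta>^4 / 16"
      using \<delta> by (simp add: \<eta>_def field_simps)
    have "cmod (ip (e i) f) \<le> ip_norm ip (e i) * C" if "f \<in> B" for i f
      using norm_ip_le[OF e BH[OF that], of i] mult_left_mono[OF norm_le[OF that] ip_norm_nonneg[OF e], of i]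
      by linarith
    from finite_net_of_bounded_coordinates[where c = "\<lambda>i. ip (e i)", OF J this \<eta>]
    obtain N where N: "finite N" "N \<subseteq> B"
      "\<And>f. f \<in> B \<Longrightarrow> \<exists>g\<in>N. \<forall>i\<in>J. (cmod (ip (e i) f - ip (e i) g))\<^sup>2 \<le> 2 * \<eta>\<^sup>2" by blast
    have "\<exists>g\<in>N. f \<in> mball g \<delta>" if f: "f \<in> B" for f
    proof -
      obtain g where g: "g \<in> N" "\<forall>i\<in>J. (cmod (ip (e i) f - ip (e i) g))\<^sup>2 \<le> 2 * \<eta>\<^sup>2"
        using N(3)[OF f] by blast
      have gB: "g \<in> B" using g N by blast
      define h where "h = (\<lambda>x. f x - g x)"
      have h: "h \<in> H" unfolding h_def using BH f gB diff_mem by blast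
      have "ip_norm ip h \<le> ip_norm ip f + ip_norm ip g"
        using ip_norm_add[OF BH[OF f] scale_mem[OF BH[OF gB]], of "-1"] ip_norm_scale[OF BH[OF gB], of "-1"]
        by (simp add: h_def)
      then have "ip_norm ip h \<le> 2 * C" using norm_le[OF f] norm_le[OF gB] by linarith
      then have "(ip_norm ip h)\<^sup>2 \<le> (2 * C)\<^sup>2" by (intro power_mono ip_norm_nonneg[OF h])
      then have "\<epsilon> * (ip_norm ip h)\<^sup>2 \<le> \<epsilon> * (4 * C\<^sup>2)"
        using \<epsilon>(1) by (intro mult_left_mono) (auto simp: power_mult_distrib)
      then have 1: "\<epsilon> * (ip_norm ip h)\<^sup>2 \<le> \<delta>^4 / 16" using \<epsilon>(2) by linarith
      have "(\<Sum>i\<in>J. (cmod (ip (e i) h))\<^sup>2) \<le> (\<Sum>i\<in>J. 2 * \<eta>\<^sup>2)"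
        using g by (intro sum_mono) (simp add: h_def ip_diff_right BH f gB e)
      then have 2: "\<epsilon> * (ip_norm ip h)\<^sup>2 + (\<Sum>i\<in>J. (cmod (ip (e i) h))\<^sup>2) \<le> (\<delta>\<^sup>2 / 2)\<^sup>2 / 2"
        using 1 \<eta>2 by (simp add: power_divide)
      have 3: "cmod (ip k h) < \<delta>\<^sup>2 / 2" if "k \<in> B" for k
      proof (rule power_less_imp_less_base)
        have "(cmod (ip k h))\<^sup>2 \<le> (\<delta>\<^sup>2 / 2)\<^sup>2 / 2" using Jh[OF that h] 2 by linarith
        also have "\<dots> < (\<delta>\<^sup>2 / 2)\<^sup>2" using \<delta> by simp
        finally show "(cmod (ip k h))\<^sup>2 < (\<delta>\<^sup>2 / 2)\<^sup>2" .
      qed simp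
      \<comment> \<open>The estimate holds for elements of \<open>B\<close>, and \<open>h\<close>
        need not be one; so \<open>h\<close> serves as test vector, and only the first argument is
        split into \<open>f\<close> and \<open>g\<close>.\<close>
      have "ip h h = ip f h - ip g h"
        using ip_diff_left[OF BH[OF f] BH[OF gB] h] by (simp add: h_def)
      moreover have "cmod (ip h h) = (ip_norm ip h)\<^sup>2"
        unfolding ip_self[OF h] norm_of_real by simp
      ultimately have "(ip_norm ip h)\<^sup>2 \<le> cmod (ip f h) + cmod (ip g h)"
        using norm_triangle_ineq4[of "ip f h" "ip g h"] by simp
      then have "(ip_norm ip h)\<^sup>2 < \<delta>\<^sup>2" using 3[OF f] 3[OF gB] by simp
      then have "ip_norm ip h < \<delta>" using \<delta> by (simp add: power_less_imp_less_base)
      then have "f \<in> mball g \<delta>"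
        using BH[OF f] BH[OF gB] commute[of f g] by (simp add: ip_dist_def h_def)
      then show ?thesis using g by blast
    qed
    then show "\<exists>K. finite K \<and> K \<subseteq> B \<and> B \<subseteq> (\<Union>x\<in>K. mball x \<delta>)"
      using N by (intro exI[of _ N]) blast
  qed
  then show ?thesis using mtotally_bounded_eq_compact_closure_of[OF complete] by blast
qed

end

section \<open>The power series of the kernel\<close>

context hilbert_function_space
begin

lemma norm_comb_power2:
  assumes y: "y \<in> fin_coeffs X"
  shows "complex_of_real ((ip_norm ip (comb y))\<^sup>2)
    = (\<Sum>z | y z \<noteq> 0. \<Sum>w | y w \<noteq> 0. cnj (y z) * y w * K z w)"
proof -
  have "complex_of_real ((ip_norm ip (comb y))\<^sup>2) = pairing (comb y) y"
    using ip_self[OF comb_mem[OF y]] ip_comb[OF y comb_mem[OF y]] by simp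
  also have "\<dots> = (\<Sum>z | y z \<noteq> 0. \<Sum>w | y w \<noteq> 0. cnj (y z) * y w * K z w)"
    unfolding pairing_def comb_def sum_distrib_left
    by (intro sum.cong refl) (use y in \<open>auto simp: fin_coeffs_def kernel_at_def\<close>)
  finally show ?thesis .
qed

end

section \<open>The hermitian product and the binomial series\<close>

lemma cmod_hprod_le: "cmod (hprod z w) \<le> norm z * norm w"
proof -
  have "cmod (hprod z w) \<le> (\<Sum>i\<in>UNIV. \<bar>cmod (z $ i)\<bar> * \<bar>cmod (w $ i)\<bar>)"
    unfolding hprod_def by (rule order_trans[OF norm_sum]) (simp add: norm_mult)
  also have "\<dots> \<le> norm z * norm w"
    unfolding norm_vec_def by (rule L2_set_mult_ineq)
  finally show ?thesis .
qed

lemma cmod_hprod_less_1: "norm z < 1 \<Longrightarrow> norm w < 1 \<Longrightarrow> cmod (hprod z w) < 1"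
  using cmod_hprod_le[of z w] mult_strict_mono'[of "norm z" 1 "norm w" 1] by simp

lemma hprod_self: "hprod z z = of_real ((norm z)\<^sup>2)"
proof -
  have "hprod z z = of_real (\<Sum>i\<in>UNIV. (cmod (z $ i))\<^sup>2)"
    unfolding hprod_def of_real_sum by (simp only: complex_norm_square)
  then show ?thesis
    by (simp add: norm_vec_def L2_set_def sum_nonneg)
qed

lemma hprod_commute: "hprod w z = cnj (hprod z w)"
  by (simp add: hprod_def mult.commute)

text \<open>The Taylor coefficients of \<open>(1 - t) powr (- \<gamma>)\<close>.\<close>

definition neg_binomial_coeff :: "real \<Rightarrow> nat \<Rightarrow> real"
  where "neg_binomial_coeff \<gamma> n = pochhammer \<gamma> n / fact n"

lemma neg_binomial_coeff_pos: "\<gamma> > 0 \<Longrightarrow> neg_binomial_coeff \<gamma> n > 0"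
  by (simp add: neg_binomial_coeff_def pochhammer_pos)

text \<open>Consecutive coefficients have ratio \<open>(\<gamma> + n) / (1 + n)\<close>.
  Monotonicity lets multiplication by a linear form, which shifts degrees by one, be bounded
  termwise.\<close>

lemma neg_binomial_coeff_le_Suc:
  assumes "\<gamma> \<ge> 1"
  shows "neg_binomial_coeff \<gamma> n \<le> neg_binomial_coeff \<gamma> (Suc n)"
proof -
  have "neg_binomial_coeff \<gamma> (Suc n) = neg_binomial_coeff \<gamma> n * ((\<gamma> + n) / (1 + n))"
    by (simp add: neg_binomial_coeff_def pochhammer_Suc)
  moreover have "1 \<le> (\<gamma> + n) / (1 + n)"
    using assms by simp
  ultimately show ?thesis
    using mult_left_mono[of 1 "(\<gamma> + n) / (1 + n)" "neg_binomial_coeff \<gamma> n"]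
      neg_binomial_coeff_pos[of \<gamma> n] assms by simp
qed

text \<open>Split off either the first or the last factor of
  \<open>pochhammer (\<gamma> - 1) (Suc n)\<close>. The decay of this ratio is the source of
  compactness.\<close>

lemma neg_binomial_coeff_minus_1:
  assumes "\<gamma> > 1"
  shows "neg_binomial_coeff (\<gamma> - 1) n = (\<gamma> - 1) / (\<gamma> - 1 + n) * neg_binomial_coeff \<gamma> n"
proof -
  have "pochhammer (\<gamma> - 1) n * (\<gamma> - 1 + n) = (\<gamma> - 1) * pochhammer \<gamma> n"
    using pochhammer_rec[of "\<gamma> - 1" n] pochhammer_Suc[of "\<gamma> - 1" n] by simp
  moreover have "\<gamma> - 1 + n \<noteq> 0" using assms by simp
  ultimately have "pochhammer (\<gamma> - 1) n = (\<gamma> - 1) * pochhammer \<gamma> n / (\<gamma> - 1 + n)"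
    by (simp only: nonzero_eq_divide_eq not_False_eq_True)
  then show ?thesis
    by (simp add: neg_binomial_coeff_def)
qed

lemma s_kernel_sums:
  assumes "norm z < 1" "norm w < 1"
  shows "(\<lambda>n. of_real (neg_binomial_coeff \<gamma> n) * hprod z w ^ n) sums s_kernel \<gamma> z w"
proof -
  have "((- of_real \<gamma> :: complex) gchoose n) * (- hprod z w) ^ n
      = of_real (neg_binomial_coeff \<gamma> n) * hprod z w ^ n" for n
  proof -
    have "(- 1) ^ n * (- hprod z w) ^ n = hprod z w ^ n"
      by (simp add: power_mult_distrib[symmetric])
    then show ?thesis
      by (simp add: gbinomial_pochhammer neg_binomial_coeff_def pochhammer_of_real mult_ac)
  qed
  then show ?thesis
    using gen_binomial_complex[of "- hprod z w" "- of_real \<gamma>"] cmod_hprod_less_1[OF assms]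
    by (simp add: s_kernel_def)
qed

text \<open>Words rather than multi-indices: then \<open>\<langle>z, w\<rangle>\<^sup>n\<close> is a sum with all coefficients \<open>1\<close>.\<close>

definition word_monomial :: "'d::finite list \<Rightarrow> complex^'d \<Rightarrow> complex"
  where "word_monomial I z = (\<Prod>i\<leftarrow>I. z $ i)"

lemma sum_words_Suc:
  "(\<Sum>I | length I = Suc n. f I) = (\<Sum>i\<in>UNIV. \<Sum>I | length I = n. f (i # I))"
  for f :: "'d::finite list \<Rightarrow> 'b::comm_monoid_add"
proof -
  have "(\<Sum>I | length I = Suc n. f I) = (\<Sum>(i, I)\<in>UNIV \<times> {I. length I = n}. f (i # I))"
    by (rule sum.reindex_bij_witness[of _ "\<lambda>(i, I). i # I" "\<lambda>I. (hd I, tl I)"])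
      (auto simp: length_Suc_conv)
  then show ?thesis by (simp add: sum.cartesian_product)
qed

lemma hprod_power:
  "hprod z w ^ n = (\<Sum>I | length I = n. word_monomial I z * cnj (word_monomial I w))"
proof (induction n)
  case (Suc n)
  then show ?case
    unfolding sum_words_Suc power_Suc
    by (simp add: hprod_def word_monomial_def sum_product mult_ac)
qed (simp add: word_monomial_def)

text \<open>The quadratic form of the kernel \<open>hprod z w ^ n\<close>, written as a sum of
  squares so that its positivity is visible.\<close>

definition homogeneous_form :: "nat \<Rightarrow> (complex^'d::finite \<Rightarrow> complex) \<Rightarrow> real"
  where "homogeneous_form n y = (\<Sum>I | length I = n. (cmod (pairing (word_monomial I) y))\<^sup>2)"

lemma homogeneous_form_nonneg: "0 \<le> homogeneous_form n y"
  unfolding homogeneous_form_def by (intro sum_nonneg) simp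

lemma homogeneous_form_eq:
  "complex_of_real (homogeneous_form n y)
    = (\<Sum>z | y z \<noteq> 0. \<Sum>w | y w \<noteq> 0. cnj (y z) * y w * hprod z w ^ n)"
proof -
  let ?S = "{w. y w \<noteq> 0}" and ?W = "{I :: 'a list. length I = n}"
  have "complex_of_real (homogeneous_form n y)
      = (\<Sum>I\<in>?W. pairing (word_monomial I) y * cnj (pairing (word_monomial I) y))"
    unfolding homogeneous_form_def of_real_sum by (simp only: complex_norm_square)
  also have "\<dots> = (\<Sum>I\<in>?W. \<Sum>z\<in>?S. \<Sum>w\<in>?S.
      cnj (y z) * y w * (word_monomial I z * cnj (word_monomial I w)))"
    unfolding pairing_def cnj_sum sum_product
    by (intro sum.cong refl) (simp add: mult_ac)
  also have "\<dots> = (\<Sum>z\<in>?S. \<Sum>I\<in>?W. \<Sum>w\<in>?S.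
      cnj (y z) * y w * (word_monomial I z * cnj (word_monomial I w)))"
    by (rule sum.swap)
  also have "\<dots> = (\<Sum>z\<in>?S. \<Sum>w\<in>?S. \<Sum>I\<in>?W.
      cnj (y z) * y w * (word_monomial I z * cnj (word_monomial I w)))"
    by (intro sum.cong refl sum.swap)
  also have "\<dots> = (\<Sum>z\<in>?S. \<Sum>w\<in>?S. cnj (y z) * y w * hprod z w ^ n)"
    unfolding hprod_power sum_distrib_left ..
  finally show ?thesis .
qed

lemma s_kernel_form_sums:
  assumes "y \<in> fin_coeffs (ball 0 1)"
  shows "(\<lambda>n. complex_of_real (neg_binomial_coeff \<gamma> n * homogeneous_form n y)) sums
    (\<Sum>z | y z \<noteq> 0. \<Sum>w | y w \<noteq> 0. cnj (y z) * y w * s_kernel \<gamma> z w)"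
proof -
  have "(\<lambda>n. \<Sum>z | y z \<noteq> 0. \<Sum>w | y w \<noteq> 0.
      cnj (y z) * y w * (of_real (neg_binomial_coeff \<gamma> n) * hprod z w ^ n)) sums
    (\<Sum>z | y z \<noteq> 0. \<Sum>w | y w \<noteq> 0. cnj (y z) * y w * s_kernel \<gamma> z w)"
    by (intro sums_sum sums_mult s_kernel_sums) (use assms in \<open>auto simp: fin_coeffs_def\<close>)
  moreover have "(\<Sum>z | y z \<noteq> 0. \<Sum>w | y w \<noteq> 0.
      cnj (y z) * y w * (of_real (neg_binomial_coeff \<gamma> n) * hprod z w ^ n))
      = of_real (neg_binomial_coeff \<gamma> n * homogeneous_form n y)" for n
    unfolding of_real_mult homogeneous_form_eq sum_distrib_left
    by (intro sum.cong refl) (simp add: mult_ac)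
  ultimately show ?thesis by simp
qed

text \<open>The factor \<open>hprod w a\<close> prefixes one letter to each word, with weights
  \<open>cnj (a $ i)\<close>; Cauchy-Schwarz over that letter yields \<open>norm a\<close> and the
  form of the next degree.\<close>

lemma homogeneous_form_mult_hprod:
  assumes y: "y \<in> fin_coeffs X"
  shows "homogeneous_form n (\<lambda>w. cnj (hprod w a) * y w) \<le> (norm a)\<^sup>2 * homogeneous_form (Suc n) y"
proof -
  have "(cmod (pairing (word_monomial I) (\<lambda>w. cnj (hprod w a) * y w)))\<^sup>2
      \<le> (norm a)\<^sup>2 * (\<Sum>i\<in>UNIV. (cmod (pairing (word_monomial (i # I)) y))\<^sup>2)" for I
  proof -
    let ?v = "\<chi> i. pairing (word_monomial (i # I)) y"
    have "pairing (word_monomial I) (\<lambda>w. cnj (hprod w a) * y w)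
        = pairing (\<lambda>w. \<Sum>i\<in>UNIV. cnj (a $ i) * word_monomial (i # I) w) y"
      using pairing_mult[OF y, of "word_monomial I" "\<lambda>w. cnj (hprod w a)"]
      by (simp add: hprod_def word_monomial_def sum_distrib_left mult_ac)
    also have "\<dots> = hprod ?v a"
      by (simp add: pairing_sum_left pairing_scale_left hprod_def mult_ac)
    finally have "cmod (pairing (word_monomial I) (\<lambda>w. cnj (hprod w a) * y w)) \<le> norm a * norm ?v"
      using cmod_hprod_le[of ?v a] by (simp add: mult.commute)
    then have "(cmod (pairing (word_monomial I) (\<lambda>w. cnj (hprod w a) * y w)))\<^sup>2 \<le> (norm a)\<^sup>2 * (norm ?v)\<^sup>2"
      unfolding power_mult_distrib[symmetric] by (intro power_mono) auto
    then show ?thesis by (simp add: norm_vec_def L2_set_def sum_nonneg)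
  qed
  then have "homogeneous_form n (\<lambda>w. cnj (hprod w a) * y w)
      \<le> (\<Sum>I | length I = n. (norm a)\<^sup>2 * (\<Sum>i\<in>UNIV. (cmod (pairing (word_monomial (i # I)) y))\<^sup>2))"
    unfolding homogeneous_form_def by (rule sum_mono)
  also have "\<dots> = (norm a)\<^sup>2 * homogeneous_form (Suc n) y"
    unfolding homogeneous_form_def sum_words_Suc sum_distrib_left[symmetric] by (subst sum.swap) rule
  finally show ?thesis .
qed

section \<open>Multipliers acting on kernel combinations\<close>

locale weighted_ball_space = hilbert_function_space "ball 0 1" H ip "s_kernel \<beta>"
  for H :: "(complex^'d \<Rightarrow> complex) set" and ip \<beta> +
  assumes \<beta>: "\<beta> > 1"
begin

lemma norm_comb_sums:
  assumes "y \<in> fin_coeffs (ball 0 1)"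
  shows "(\<lambda>n. neg_binomial_coeff \<beta> n * homogeneous_form n y) sums (ip_norm ip (comb y))\<^sup>2"
  using s_kernel_form_sums[OF assms, of \<beta>] unfolding norm_comb_power2[OF assms, symmetric]
  by (simp only: sums_of_real_iff)

text \<open>The series for the new coefficients is dominated termwise by the series for
  \<open>y\<close> shifted by one degree: the coefficients increase since
  \<open>\<beta> \<ge> 1\<close>, and the term of degree 0 lost by the shift is nonnegative.\<close>

lemma norm_comb_mult_hprod:
  assumes y: "y \<in> fin_coeffs (ball 0 1)"
  shows "ip_norm ip (comb (\<lambda>w. cnj (hprod w a) * y w)) \<le> norm a * ip_norm ip (comb y)"
proof -
  let ?c = "neg_binomial_coeff \<beta>" and ?y = "\<lambda>w. cnj (hprod w a) * y w"
  let ?t = "\<lambda>n. ?c n * homogeneous_form n y"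
  have c: "0 < ?c n" "?c n \<le> ?c (Suc n)" for n
    using \<beta> neg_binomial_coeff_pos neg_binomial_coeff_le_Suc by auto
  have y': "?y \<in> fin_coeffs (ball 0 1)" using fin_coeffs_mult[OF y] .
  note s = norm_comb_sums[OF y] and s' = norm_comb_sums[OF y']
  have ss: "(\<lambda>n. (norm a)\<^sup>2 * ?t (Suc n)) sums ((norm a)\<^sup>2 * ((ip_norm ip (comb y))\<^sup>2 - ?t 0))"
    using s sums_Suc_iff[of ?t "(ip_norm ip (comb y))\<^sup>2 - ?t 0"] by (intro sums_mult) simp
  have "?c n * homogeneous_form n ?y \<le> (norm a)\<^sup>2 * ?t (Suc n)" for n
  proof -
    have "?c n * homogeneous_form n ?y \<le> ?c n * ((norm a)\<^sup>2 * homogeneous_form (Suc n) y)"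
      using c(1)[of n] homogeneous_form_mult_hprod[OF y, of n a] by (intro mult_left_mono) auto
    also have "\<dots> \<le> ?c (Suc n) * ((norm a)\<^sup>2 * homogeneous_form (Suc n) y)"
      using c(2)[of n] homogeneous_form_nonneg[of "Suc n" y] by (intro mult_right_mono) auto
    finally show ?thesis by (simp add: mult_ac)
  qed
  then have "(ip_norm ip (comb ?y))\<^sup>2 \<le> (norm a)\<^sup>2 * ((ip_norm ip (comb y))\<^sup>2 - ?t 0)"
    using sums_le[OF _ s' ss] by blast
  also have "\<dots> \<le> (norm a)\<^sup>2 * (ip_norm ip (comb y))\<^sup>2"
    using c(1)[of 0] homogeneous_form_nonneg[of 0 y] by (intro mult_left_mono) auto
  finally have "(ip_norm ip (comb ?y))\<^sup>2 \<le> (norm a * ip_norm ip (comb y))\<^sup>2"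
    by (simp add: power_mult_distrib)
  then show ?thesis
    by (rule power2_le_imp_le) (use ip_norm_nonneg[OF comb_mem[OF y]] in simp)
qed

text \<open>No geometric series is needed: multiplication \<open>T\<close> of the coefficients by the conjugate of
  \<open>\<langle>w, a\<rangle>\<close> has norm at most \<open>\<parallel>a\<parallel>\<close>, and \<open>v = u + T v\<close> gives \<open>\<parallel>v\<parallel> \<le> \<parallel>u\<parallel> + \<parallel>a\<parallel> \<parallel>v\<parallel>\<close>.\<close>

lemma norm_comb_divide_hprod:
  assumes y: "y \<in> fin_coeffs (ball 0 1)" and a: "norm a < 1"
  shows "ip_norm ip (comb (\<lambda>w. cnj (1 / (1 - hprod w a)) * y w)) \<le> ip_norm ip (comb y) / (1 - norm a)"
proof -
  let ?v = "\<lambda>w. cnj (1 / (1 - hprod w a)) * y w"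
  have v: "?v \<in> fin_coeffs (ball 0 1)" using fin_coeffs_mult[OF y] .
  have Tv: "(\<lambda>w. cnj (hprod w a) * ?v w) \<in> fin_coeffs (ball 0 1)" using fin_coeffs_mult[OF v] .
  have "?v w = y w + cnj (hprod w a) * ?v w" for w
  proof (cases "y w = 0")
    case False
    then have "norm w < 1" using y by (auto simp: fin_coeffs_def)
    then have "1 - hprod w a \<noteq> 0" using cmod_hprod_less_1[OF _ a, of w] by auto
    then have "1 - cnj (hprod w a) \<noteq> 0"
      by (metis complex_cnj_one complex_cnj_diff complex_cnj_zero_iff)
    then show ?thesis by (simp add: field_simps)
  qed simp
  then have "comb ?v = (\<lambda>z. comb y z + comb (\<lambda>w. cnj (hprod w a) * ?v w) z)"
    using comb_add[OF y Tv] by presburger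
  then have "ip_norm ip (comb ?v) \<le> ip_norm ip (comb y) + ip_norm ip (comb (\<lambda>w. cnj (hprod w a) * ?v w))"
    using ip_norm_add[OF comb_mem[OF y] comb_mem[OF Tv]] by simp
  also have "\<dots> \<le> ip_norm ip (comb y) + norm a * ip_norm ip (comb ?v)"
    using norm_comb_mult_hprod[OF v] by simp
  finally have "ip_norm ip (comb ?v) * (1 - norm a) \<le> ip_norm ip (comb y)"
    by (simp add: algebra_simps)
  then show ?thesis using a by (simp add: pos_le_divide_eq)
qed

end

section \<open>Automorphisms of the ball\<close>

lemma hprod_add_left: "hprod (x + y) w = hprod x w + hprod y w"
  and hprod_diff_left: "hprod (x - y) w = hprod x w - hprod y w"
  and hprod_scale_left: "hprod (c *s x) w = c * hprod x w"
  and hprod_diff_right: "hprod w (x - y) = hprod w x - hprod w y"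
  and hprod_scale_right: "hprod w (c *s x) = cnj c * hprod w x"
  by (simp_all add: hprod_def algebra_simps sum.distrib sum_subtractf sum_distrib_left)

lemma norm_vector_scalar_mult: "norm (c *s x) = cmod c * norm x" for x :: "complex^'d"
proof -
  have "complex_of_real ((norm (c *s x))\<^sup>2) = of_real ((cmod c * norm x)\<^sup>2)"
    using hprod_self[of "c *s x"] hprod_self[of x] complex_norm_square[of c]
    by (simp add: hprod_scale_left hprod_scale_right power_mult_distrib mult_ac)
  then show ?thesis
    by (simp only: of_real_eq_iff) (simp add: power2_eq_iff_nonneg)
qed

lemma axis_sum_components: "(\<Sum>i\<in>UNIV. v $ i *s axis i 1) = v" for v :: "complex^'d"
  by (simp add: vec_eq_iff axis_def if_distrib cong: if_cong)

section \<open>Holomorphic maps and complex linear derivatives\<close>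

lemma has_derivative_vec_components:
  fixes F :: "'a::real_normed_vector \<Rightarrow> complex^'m"
  assumes "\<And>i. ((\<lambda>z. F z $ i) has_derivative (\<lambda>v. D v $ i)) net"
  shows "(F has_derivative D) net"
proof -
  have bl: "bounded_linear (\<lambda>t :: complex. t *s (axis i 1 :: complex^'m))" for i
    by (intro bounded_linear_intro[where K = 1])
      (auto simp: vec_eq_iff norm_vector_scalar_mult algebra_simps)
  have "((\<lambda>z. \<Sum>i\<in>UNIV. F z $ i *s axis i 1) has_derivative (\<lambda>v. \<Sum>i\<in>UNIV. D v $ i *s axis i 1)) net"
    by (intro has_derivative_sum bounded_linear.has_derivative[OF bl] assms)
  then show ?thesis by (simp only: axis_sum_components)
qed

text \<open>A complex homogeneous real derivative is determined by its values on the axes, which are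
  the partial derivatives. In this coordinate-free form the chain rule is mere composition.\<close>

lemma holomorphic_several_iff:
  fixes f :: "complex^'d \<Rightarrow> complex"
  shows "holomorphic_several f S \<longleftrightarrow>
    (\<forall>z\<in>S. \<exists>D. (f has_derivative D) (at z within S) \<and> (\<forall>c v. D (c *s v) = c * D v))"
    (is "?lhs \<longleftrightarrow> ?rhs")
proof
  assume ?lhs
  have "(\<Sum>i\<in>UNIV. a $ i * (c *s v) $ i) = c * (\<Sum>i\<in>UNIV. a $ i * v $ i)" for a v :: "complex^'d" and c
    by (simp add: sum_distrib_left mult_ac)
  with \<open>?lhs\<close> show ?rhs
    unfolding holomorphic_several_def by fast
next
  assume R: ?rhs
  show ?lhs
    unfolding holomorphic_several_def
  proof
    fix z assume "z \<in> S"
    then obtain D where D: "(f has_derivative D) (at z within S)" "\<And>c v. D (c *s v) = c * D v"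
      using R by blast
    have lin: "linear D" using D(1) has_derivative_linear by blast
    have "D v = (\<Sum>i\<in>UNIV. (\<chi> i. D (axis i 1)) $ i * v $ i)" for v
    proof -
      have "D v = D (\<Sum>i\<in>UNIV. v $ i *s axis i 1)" by (simp only: axis_sum_components)
      also have "\<dots> = (\<Sum>i\<in>UNIV. v $ i * D (axis i 1))"
        by (simp add: linear_sum[OF lin] D(2))
      finally show ?thesis by (simp add: mult.commute)
    qed
    then have "D = (\<lambda>v. \<Sum>i\<in>UNIV. (\<chi> i. D (axis i 1)) $ i * v $ i)" by blast
    then show "\<exists>a::complex^'d. (f has_derivative (\<lambda>v. \<Sum>i\<in>UNIV. a $ i * v $ i)) (at z within S)"
      using D(1) by metis
  qed
qed

lemma holomorphic_map_iff:
  "holomorphic_map F S \<longleftrightarrow>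
    (\<forall>z\<in>S. \<exists>D. (F has_derivative D) (at z within S) \<and> (\<forall>c v. D (c *s v) = c *s D v))"
    (is "?lhs \<longleftrightarrow> ?rhs")
proof
  assume L: ?lhs
  show ?rhs
  proof
    fix z assume z: "z \<in> S"
    have "\<forall>i. \<exists>D. ((\<lambda>z. F z $ i) has_derivative D) (at z within S) \<and> (\<forall>c v. D (c *s v) = c * D v)"
      using L z unfolding holomorphic_map_def holomorphic_several_iff by blast
    then obtain D where D: "\<And>i. ((\<lambda>z. F z $ i) has_derivative D i) (at z within S)"
      "\<And>i c v. D i (c *s v) = c * D i v" by metis
    show "\<exists>D. (F has_derivative D) (at z within S) \<and> (\<forall>c v. D (c *s v) = c *s D v)"
      by (rule exI[of _ "\<lambda>v. \<chi> i. D i v"])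
        (auto intro!: has_derivative_vec_components simp: D vec_eq_iff)
  qed
next
  assume R: ?rhs
  show ?lhs
    unfolding holomorphic_map_def holomorphic_several_iff
  proof (intro allI ballI)
    fix i z assume "z \<in> S"
    then obtain D where D: "(F has_derivative D) (at z within S)" "\<And>c v. D (c *s v) = c *s D v"
      using R by blast
    show "\<exists>D. ((\<lambda>z. F z $ i) has_derivative D) (at z within S) \<and> (\<forall>c v. D (c *s v) = c * D v)"
      by (rule exI[of _ "\<lambda>v. D v $ i"])
        (simp add: D bounded_linear.has_derivative[OF bounded_linear_vec_nth D(1)])
  qed
qed

lemma holomorphic_map_compose:
  assumes F: "holomorphic_map F S" and G: "holomorphic_map G T" and "F ` S \<subseteq> T"
  shows "holomorphic_map (\<lambda>z. G (F z)) S"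
  unfolding holomorphic_map_iff
proof
  fix z assume z: "z \<in> S"
  obtain D where D: "(F has_derivative D) (at z within S)" "\<And>c v. D (c *s v) = c *s D v"
    using F z unfolding holomorphic_map_iff by blast
  have "F z \<in> T" using z assms(3) by blast
  then obtain E where E: "(G has_derivative E) (at (F z) within T)" "\<And>c v. E (c *s v) = c *s E v"
    using G unfolding holomorphic_map_iff by blast
  have "((\<lambda>z. G (F z)) has_derivative (\<lambda>v. E (D v))) (at z within S)"
    using has_derivative_in_compose[OF D(1) has_derivative_subset[OF E(1) assms(3)]] .
  then show "\<exists>D. ((\<lambda>z. G (F z)) has_derivative D) (at z within S) \<and> (\<forall>c v. D (c *s v) = c *s D v)"
    by (rule exI[of _ "\<lambda>v. E (D v)", OF conjI]) (simp add: D E)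
qed

lemma bounded_linear_hprod: "bounded_linear (\<lambda>x. hprod x u)"
proof (rule bounded_linear_intro[where K = "norm u"])
  show "hprod (r *\<^sub>R x) u = r *\<^sub>R hprod x u" for r x
    by (simp add: hprod_def scaleR_sum_right)
qed (rule hprod_add_left, rule cmod_hprod_le)

text \<open>Restricting to a complex line and testing against \<open>u\<close> gives a function of
  one variable, to which the classical Schwarz lemma applies.\<close>

lemma holomorphic_on_line:
  assumes F: "holomorphic_map F (ball 0 1)" and v: "norm v = 1"
  shows "(\<lambda>t. hprod (F (t *s v)) u) holomorphic_on ball 0 1"
  unfolding holomorphic_on_def
proof
  fix t :: complex assume t: "t \<in> ball 0 1"
  let ?l = "\<lambda>t. t *s v"
  have l: "?l ` ball 0 1 \<subseteq> ball 0 1" using v by (auto simp: norm_vector_scalar_mult)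
  have dl: "(?l has_derivative ?l) (at t within ball 0 1)"
    by (intro bounded_linear_imp_has_derivative bounded_linear_intro[where K = 1])
      (auto simp: vec_eq_iff norm_vector_scalar_mult v algebra_simps)
  obtain D where D: "(F has_derivative D) (at (?l t) within ball 0 1)" "\<And>c v. D (c *s v) = c *s D v"
    using F t l unfolding holomorphic_map_iff by blast
  have bl: "bounded_linear (\<lambda>x. hprod x u)" by (rule bounded_linear_hprod)
  have "((\<lambda>t. hprod (F (?l t)) u) has_derivative (\<lambda>s. hprod (D (?l s)) u)) (at t within ball 0 1)"
    by (intro bounded_linear.has_derivative[OF bl]
        has_derivative_in_compose[OF dl has_derivative_subset[OF D(1) l]])
  moreover have "(\<lambda>s. hprod (D (?l s)) u) = (*) (hprod (D v) u)"
    by (simp add: fun_eq_iff D(2) hprod_scale_left)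
  ultimately show "(\<lambda>t. hprod (F (t *s v)) u) field_differentiable at t within ball 0 1"
    unfolding field_differentiable_def has_field_derivative_def by auto
qed

section \<open>The Schwarz lemma on the ball\<close>

lemma scale_unit: "z \<noteq> 0 \<Longrightarrow> \<exists>v. norm v = 1 \<and> z = of_real (norm z) *s v" for z :: "complex^'d"
  by (rule exI[of _ "of_real (1 / norm z) *s z"])
    (simp add: norm_vector_scalar_mult vec_eq_iff norm_divide)

text \<open>With \<open>v\<close> the direction of \<open>z\<close> and \<open>u\<close> that of
  \<open>F z\<close>, the one-variable slice takes the value \<open>norm (F z)\<close> at
  \<open>norm z\<close>.\<close>

lemma norm_Schwarz:
  assumes F: "holomorphic_map F (ball 0 1)" and im: "F ` ball 0 1 \<subseteq> ball 0 1" and F0: "F 0 = 0"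
    and z: "norm z < 1"
  shows "norm (F z) \<le> norm z"
proof (cases "F z = 0")
  case False
  then have "z \<noteq> 0" using F0 by auto
  then obtain v where v: "norm v = 1" "z = of_real (norm z) *s v" using scale_unit by blast
  obtain u where u: "norm u = 1" "F z = of_real (norm (F z)) *s u" using scale_unit[OF False] by blast
  let ?g = "\<lambda>t. hprod (F (t *s v)) u"
  have lt: "cmod (?g t) < 1" if "cmod t < 1" for t
  proof -
    have "norm (F (t *s v)) < 1" using im that v by (auto simp: norm_vector_scalar_mult image_subset_iff)
    then show ?thesis using cmod_hprod_le[of "F (t *s v)" u] u by simp
  qed
  have "cmod (?g (of_real (norm z))) \<le> cmod (of_real (norm z))"
    by (rule Schwarz_Lemma(1)[OF holomorphic_on_line[OF F v(1)] _ lt])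
      (use z F0 in \<open>auto simp: hprod_def vec_eq_iff\<close>)
  then have "cmod (hprod (F z) u) \<le> norm z" using v(2) by simp
  moreover have "hprod (F z) u = of_real (norm (F z))"
    using u(2) hprod_self[of u] u(1) by (metis hprod_scale_left mult.right_neutral of_real_1 power_one)
  ultimately show ?thesis by simp
qed simp

lemma norm_diff_power2:
  "(norm (x - y))\<^sup>2 = (norm x)\<^sup>2 - 2 * Re (hprod x y) + (norm y)\<^sup>2" for x y :: "complex^'d"
proof -
  have "complex_of_real ((norm (x - y))\<^sup>2) = hprod x x - (hprod x y + cnj (hprod x y)) + hprod y y"
    unfolding hprod_self[symmetric] using hprod_commute[of y x]
    by (simp add: hprod_diff_left hprod_diff_right algebra_simps)
  then show ?thesis
    unfolding hprod_self complex_add_cnj by (simp add: complex_eq_iff)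
qed

text \<open>The equality case of the Schwarz lemma on each complex line through \<open>0\<close>.\<close>

lemma norm_preserving_line:
  assumes F: "holomorphic_map F (ball 0 1)" and F0: "F 0 = 0"
    and norm: "\<And>z. norm z < 1 \<Longrightarrow> norm (F z) = norm z" and v: "norm v = 1"
  shows "\<exists>u. \<forall>t. cmod t < 1 \<longrightarrow> F (t *s v) = t *s u"
proof -
  \<comment> \<open>If \<open>F\<close> is linear on the line, its value at \<open>1/2\<close>
    determines \<open>u\<close>; the same point witnesses the equality case of Schwarz and gives
    \<open>\<alpha> = 1\<close>.\<close>
  define u where "u = 2 *s F ((1/2) *s v)"
  have n: "norm (F (t *s v)) = cmod t" if "cmod t < 1" for t
    using norm[of "t *s v"] that v by (simp add: norm_vector_scalar_mult)
  have u: "norm u = 1" using n[of "1/2"] by (simp add: u_def norm_vector_scalar_mult)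
  have Fu: "F ((1/2) *s v) = (1/2) *s u" by (simp add: u_def vec_eq_iff)
  let ?g = "\<lambda>t. hprod (F (t *s v)) u"
  have g_half: "?g (1/2) = 1/2"
    unfolding Fu hprod_scale_left hprod_self using u by simp
  have "\<exists>\<alpha>. (\<forall>t. norm t < 1 \<longrightarrow> ?g t = \<alpha> * t) \<and> norm \<alpha> = 1"
  proof (rule Schwarz_Lemma(3)[OF holomorphic_on_line[OF F v], of u 0])
    show "norm (?g t) < 1" if "norm t < 1" for t
      using cmod_hprod_le[of "F (t *s v)" u] u n[OF that] that by simp
    show "(\<exists>z. cmod z < 1 \<and> z \<noteq> 0 \<and> cmod (?g z) = cmod z) \<or> cmod (deriv ?g 0) = 1"
      by (rule disjI1, rule exI[of _ "1/2"]) (simp only: g_half, simp)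
  qed (use F0 in \<open>auto simp: hprod_def\<close>)
  then obtain \<alpha> where \<alpha>: "\<And>t. norm t < 1 \<Longrightarrow> ?g t = \<alpha> * t" by blast
  have "\<alpha> = 1" using \<alpha>[of "1/2"] g_half by simp
  \<comment> \<open>Equality in Cauchy-Schwarz: both vectors have norm \<open>cmod t\<close>, and
    their product is \<open>(cmod t)\<^sup>2\<close>, so they coincide.\<close>
  have "F (t *s v) = t *s u" if t: "cmod t < 1" for t
  proof -
    have "hprod (F (t *s v)) (t *s u) = of_real ((cmod t)\<^sup>2)"
      using \<alpha>[OF t] \<open>\<alpha> = 1\<close> complex_norm_square[of t] by (simp add: hprod_scale_right mult.commute)
    then have "(norm (F (t *s v) - t *s u))\<^sup>2 = 0"
      unfolding norm_diff_power2 using n[OF t] u by (simp add: norm_vector_scalar_mult)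
    then show ?thesis by simp
  qed
  then show ?thesis by blast
qed

text \<open>\<open>F\<close> is linear on each complex line through \<open>0\<close>, hence equal to its derivative at \<open>0\<close>; polarisation
  does the rest.\<close>

lemma norm_preserving_imp_hprod_preserving:
  fixes F :: "complex^'d \<Rightarrow> complex^'d"
  assumes F: "holomorphic_map F (ball 0 1)" and F0: "F 0 = 0"
    and norm: "\<And>z. norm z < 1 \<Longrightarrow> norm (F z) = norm z"
    and z: "norm z < 1" and w: "norm w < 1"
  shows "hprod (F z) (F w) = hprod z w"
proof -
  obtain D where D: "(F has_derivative D) (at 0 within ball 0 1)" "\<And>c v. D (c *s v) = c *s D v"
    using F unfolding holomorphic_map_iff by fastforce
  have "at 0 within ball 0 1 = at (0::complex^'d)" by (rule at_within_open) auto
  then have D0: "(F has_derivative D) (at 0)" using D(1) by simp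
  have lin: "linear D" using D0 has_derivative_linear by blast
  have FD: "F x = D x" if x: "norm x < 1" for x
  proof (cases "x = 0")
    case False
    obtain v where v: "norm v = 1" "x = of_real (norm x) *s v" using scale_unit[OF False] by blast
    obtain u where u: "\<And>t. cmod t < 1 \<Longrightarrow> F (t *s v) = t *s u"
      using norm_preserving_line[OF F F0 norm v(1)] by blast
    have sc: "complex_of_real r *s y = r *\<^sub>R y" for r and y :: "complex^'d"
      by (simp add: vec_eq_iff scaleR_conv_of_real[where 'a = complex])
    \<comment> \<open>The curve \<open>r \<mapsto> F (r *\<^sub>R v)\<close> has derivative
      \<open>D v\<close> at 0 by the chain rule and \<open>u\<close> by linearity on the
      line.\<close>
    have 1: "((\<lambda>r. F (r *\<^sub>R v)) has_vector_derivative D v) (at 0)"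
    proof -
      have "((\<lambda>r. F (r *\<^sub>R v)) has_derivative (\<lambda>r. D (r *\<^sub>R v))) (at 0)"
        by (rule has_derivative_compose[of "\<lambda>r. r *\<^sub>R v" "\<lambda>r. r *\<^sub>R v" 0 UNIV F])
          (auto intro!: derivative_eq_intros D0)
      then show ?thesis
        by (simp add: has_vector_derivative_def linear_scale[OF lin])
    qed
    have "((\<lambda>r. r *\<^sub>R u) has_vector_derivative u) (at (0::real))"
      by (auto intro!: derivative_eq_intros simp: has_vector_derivative_def)
    then have "((\<lambda>r. F (r *\<^sub>R v)) has_vector_derivative u) (at 0)"
      by (rule has_vector_derivative_transform_within_open[of _ _ _ "ball 0 1"])
        (use u[of "of_real _"] in \<open>auto simp: sc\<close>)
    then have "u = D v" using 1 vector_derivative_unique_at by blast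
    then show ?thesis using u[of "of_real (norm x)"] v(2) x D(2) by (metis norm_of_real abs_norm_cancel)
  qed (simp add: F0 linear_0[OF lin])
  have normD: "norm (D x) = norm x" for x
  proof (cases "x = 0")
    case False
    define c where "c = complex_of_real (1 / (2 * norm x))"
    have c: "cmod c * norm x = 1/2" "c \<noteq> 0" using False by (auto simp: c_def norm_mult norm_divide)
    have "norm (D (c *s x)) = norm (c *s x)"
      using norm[of "c *s x"] FD[of "c *s x"] c by (simp add: norm_vector_scalar_mult)
    then show ?thesis using c(2) by (simp add: D(2) norm_vector_scalar_mult)
  qed (simp add: linear_0[OF lin])
  have Re_eq: "Re (hprod (D x) (D y)) = Re (hprod x y)" for x y
    using norm_diff_power2[of "D x" "D y"] norm_diff_power2[of x y] normD[of "x - y"]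
    by (simp add: normD linear_diff[OF lin])
  have "hprod (D x) (D y) = hprod x y" for x y
    using Re_eq[of x y] Re_eq[of "\<i> *s x" y] by (simp add: D(2) hprod_scale_left complex_eq_iff)
  then show ?thesis using FD z w by simp
qed

section \<open>The Moebius involution exchanging 0 and \<open>a\<close>\<close>

locale moebius_point =
  fixes a :: "complex^'d"
  assumes a: "norm a < 1"
begin

definition s :: complex where "s = complex_of_real (sqrt (1 - (norm a)\<^sup>2))"

text \<open>The usual formula \<open>(a - P z - s Q z) / (1 - \<langle>z, a\<rangle>)\<close> with \<open>P\<close> the orthogonal projection to
  \<open>\<complex> a\<close> and \<open>Q = I - P\<close>; since \<open>1 - s\<^sup>2 = \<parallel>a\<parallel>\<^sup>2\<close>, the division by \<open>\<parallel>a\<parallel>\<^sup>2\<close> in \<open>P\<close> cancels.\<close>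

definition moebius :: "complex^'d \<Rightarrow> complex^'d"
  where "moebius z = (1 / (1 - hprod z a)) *s ((1 - hprod z a / (1 + s)) *s a - s *s z)"

lemma moebius_nth:
  "moebius z $ i = ((1 - hprod z a / (1 + s)) * a $ i - s * z $ i) / (1 - hprod z a)"
  by (simp only: moebius_def vector_smult_component vector_minus_component times_divide_eq_left mult_1_left)

lemma norm_a_power2: "(norm a)\<^sup>2 < 1"
  using a by (simp add: power_less_one_iff)

lemma s_power2: "s\<^sup>2 = 1 - hprod a a"
  using norm_a_power2 by (simp add: s_def hprod_self of_real_power[symmetric] del: of_real_power)

lemma s_nonzero: "s \<noteq> 0" "1 + s \<noteq> 0" "cnj s = s"
proof -
  have "sqrt (1 - (norm a)\<^sup>2) > 0" using norm_a_power2 by simp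
  then have "sqrt (1 - (norm a)\<^sup>2) \<noteq> 0" "1 + sqrt (1 - (norm a)\<^sup>2) \<noteq> 0" by linarith+
  moreover have "1 + s = of_real (1 + sqrt (1 - (norm a)\<^sup>2))" by (simp add: s_def)
  ultimately show "s \<noteq> 0" "1 + s \<noteq> 0" "cnj s = s"
    by (auto simp: s_def simp del: of_real_add)
qed

lemma one_minus_hprod_nonzero:
  assumes "norm z < 1"
  shows "1 - hprod z a \<noteq> 0" "1 - hprod a z \<noteq> 0"
  using cmod_hprod_less_1[OF assms a] cmod_hprod_less_1[OF a assms] by auto

lemma one_minus_hprod_moebius:
  assumes z: "norm z < 1" and w: "norm w < 1"
  shows "1 - hprod (moebius z) (moebius w)
    = s\<^sup>2 * (1 - hprod z w) / ((1 - hprod z a) * (1 - hprod a w))"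
proof -
  define \<alpha> \<beta> \<gamma> where "\<alpha> = hprod z a" and "\<beta> = hprod a w" and "\<gamma> = hprod z w"
  have nz: "1 - \<alpha> \<noteq> 0" "1 - \<beta> \<noteq> 0" "1 + s \<noteq> 0"
    using one_minus_hprod_nonzero z w s_nonzero by (auto simp: \<alpha>_def \<beta>_def)
  have cnj: "cnj (hprod w a) = \<beta>" using hprod_commute[of a w] by (simp add: \<beta>_def)
  have aa: "hprod a a = (1 + s) * (1 - s)" using s_power2 by (simp add: algebra_simps power2_eq_square)
  \<comment> \<open>\<open>B\<close> is built from \<open>hprod a w\<close>, so the scalar in
    \<open>moebius w\<close> is \<open>cnj B\<close>; conjugate linearity in the second argument
    then produces \<open>B\<close>.\<close>
  define A B where "A = 1 - \<alpha> / (1 + s)" and "B = 1 - \<beta> / (1 + s)"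
  have A: "A * (1 + s) = 1 + s - \<alpha>" "B * (1 + s) = 1 + s - \<beta>"
    using nz by (simp_all add: A_def B_def left_diff_distrib)
  have "hprod (A *s a - s *s z) (cnj B *s a - s *s w)
      = A * B * (1 + s) * (1 - s) - s * A * \<beta> - s * B * \<alpha> + s\<^sup>2 * \<gamma>"
    unfolding hprod_scale_left hprod_scale_right hprod_diff_left hprod_diff_right
    by (simp add: aa s_nonzero \<alpha>_def \<beta>_def \<gamma>_def) (simp add: algebra_simps power2_eq_square)
  moreover have "moebius z = (1 / (1 - \<alpha>)) *s (A *s a - s *s z)"
    by (simp only: moebius_def A_def \<alpha>_def)
  moreover have "moebius w = cnj (1 / (1 - \<beta>)) *s (cnj B *s a - s *s w)"
    unfolding moebius_def B_def cnj[symmetric] by (simp add: s_nonzero)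
  ultimately have "hprod (moebius z) (moebius w)
      = (A * B * (1 + s) * (1 - s) - s * A * \<beta> - s * B * \<alpha> + s\<^sup>2 * \<gamma>) / ((1 - \<alpha>) * (1 - \<beta>))"
    by (simp only: hprod_scale_left hprod_scale_right complex_cnj_cnj) simp
  \<comment> \<open>Multiplying by \<open>1 + s\<close> turns \<open>A\<close> and \<open>B\<close>
    into polynomials, and the claim into a polynomial identity.\<close>
  moreover have "A * B * (1 + s) * (1 - s) - s * A * \<beta> - s * B * \<alpha> = (1 - \<alpha>) * (1 - \<beta>) - s\<^sup>2"
  proof -
    have "(A * B * (1 + s) * (1 - s) - s * A * \<beta> - s * B * \<alpha>) * (1 + s)
        = (A * (1 + s)) * (B * (1 + s)) * (1 - s) - s * (A * (1 + s)) * \<beta> - s * (B * (1 + s)) * \<alpha>"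
      by (simp add: algebra_simps)
    also have "\<dots> = ((1 - \<alpha>) * (1 - \<beta>) - s\<^sup>2) * (1 + s)"
      unfolding A by (simp add: algebra_simps power2_eq_square)
    finally show ?thesis using nz by simp
  qed
  ultimately show ?thesis
    using nz unfolding \<alpha>_def[symmetric] \<beta>_def[symmetric] \<gamma>_def[symmetric]
    by (simp add: divide_simps) (simp add: algebra_simps)
qed

text \<open>For \<open>w = z\<close> the identity expresses
  \<open>1 - (norm (moebius z))\<^sup>2\<close> as a quotient of positive numbers.\<close>

lemma norm_moebius:
  assumes z: "norm z < 1"
  shows "norm (moebius z) < 1"
proof -
  have "hprod a z = cnj (hprod z a)" by (rule hprod_commute)
  then have "(1 - hprod z a) * (1 - hprod a z) = of_real ((cmod (1 - hprod z a))\<^sup>2)"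
    unfolding complex_norm_square by simp
  moreover have "s\<^sup>2 = of_real (1 - (norm a)\<^sup>2)" by (simp add: s_power2 hprod_self)
  ultimately have "complex_of_real (1 - (norm (moebius z))\<^sup>2)
      = of_real ((1 - (norm a)\<^sup>2) * (1 - (norm z)\<^sup>2) / (cmod (1 - hprod z a))\<^sup>2)"
    using one_minus_hprod_moebius[OF z z] by (simp add: hprod_self)
  then have "1 - (norm (moebius z))\<^sup>2 = (1 - (norm a)\<^sup>2) * (1 - (norm z)\<^sup>2) / (cmod (1 - hprod z a))\<^sup>2"
    by (simp only: of_real_eq_iff)
  also have "\<dots> > 0"
    using norm_a_power2 z one_minus_hprod_nonzero[OF z] by (simp add: power_less_one_iff)
  finally show ?thesis by (simp add: power_less_one_iff)
qed

lemma moebius_0: "moebius 0 = a"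
  and moebius_self: "moebius a = 0"
proof -
  show "moebius 0 = a" by (simp add: moebius_def hprod_def)
  have "(1 - hprod a a / (1 + s)) = s"
    using s_power2 s_nonzero(2) by (simp add: field_simps power2_eq_square)
  then show "moebius a = 0" by (simp add: moebius_def)
qed

text \<open>Pairing \<open>moebius z\<close> with \<open>a\<close> gives \<open>\<alpha>'\<close>
  with \<open>(1 - \<alpha>') * (1 - \<alpha>) = s\<^sup>2\<close>. In the second application the
  multiples of \<open>a\<close> therefore cancel and \<open>s\<^sup>2 * z\<close> is divided by
  \<open>s\<^sup>2\<close>.\<close>

lemma moebius_involution:
  assumes z: "norm z < 1"
  shows "moebius (moebius z) = z"
proof -
  define \<alpha> where "\<alpha> = hprod z a"
  have nz: "1 - \<alpha> \<noteq> 0" "1 + s \<noteq> 0" "s \<noteq> 0"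
    using one_minus_hprod_nonzero z s_nonzero by (auto simp: \<alpha>_def)
  have aa: "hprod a a = (1 + s) * (1 - s)" using s_power2 by (simp add: algebra_simps power2_eq_square)
  define A where "A = 1 - \<alpha> / (1 + s)"
  have A: "A * (1 + s) = 1 + s - \<alpha>" using nz by (simp add: A_def left_diff_distrib)
  define \<alpha>' where "\<alpha>' = hprod (moebius z) a"
  have "\<alpha>' = (A * (1 + s) * (1 - s) - s * \<alpha>) / (1 - \<alpha>)"
    unfolding \<alpha>'_def moebius_def hprod_scale_left hprod_diff_left
    by (simp add: aa \<alpha>_def[symmetric] A_def[symmetric] mult_ac)
  then have "\<alpha>' * (1 - \<alpha>) = A * (1 + s) * (1 - s) - s * \<alpha>" using nz(1) by simp
  then have \<alpha>': "\<alpha>' * (1 - \<alpha>) = 1 - s\<^sup>2 - \<alpha>"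
    unfolding A by (simp add: algebra_simps power2_eq_square)
  then have d: "(1 - \<alpha>') * (1 - \<alpha>) = s\<^sup>2" by (simp add: algebra_simps)
  have d0: "1 - \<alpha>' \<noteq> 0" using d nz by auto
  have 1: "(1 - \<alpha>' / (1 + s)) * (1 - \<alpha>) = s * A"
  proof -
    have "(1 - \<alpha>' / (1 + s)) * (1 - \<alpha>) * (1 + s) = (1 + s) * (1 - \<alpha>) - \<alpha>' * (1 - \<alpha>)"
      using nz by (simp add: field_simps)
    also have "\<dots> = s * A * (1 + s)"
      unfolding \<alpha>' mult.assoc A by (simp add: algebra_simps power2_eq_square)
    finally show ?thesis using nz by simp
  qed
  have comp: "moebius z $ i = (A * a $ i - s * z $ i) / (1 - \<alpha>)" for i
    by (simp only: moebius_nth \<alpha>_def A_def)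
  have "moebius (moebius z) $ i = z $ i" for i
  proof -
    have "moebius (moebius z) $ i
        = ((1 - \<alpha>' / (1 + s)) * a $ i - s * (A * a $ i - s * z $ i) / (1 - \<alpha>)) / (1 - \<alpha>')"
      unfolding moebius_nth[of "moebius z"] \<alpha>'_def comp by simp
    also have "\<dots> = (((1 - \<alpha>' / (1 + s)) * (1 - \<alpha>)) * a $ i - s * (A * a $ i - s * z $ i)) / ((1 - \<alpha>') * (1 - \<alpha>))"
      using nz(1) by (simp add: diff_divide_eq_iff mult_ac)
    also have "\<dots> = z $ i"
      unfolding 1 d using nz(3) by (simp add: algebra_simps power2_eq_square)
    finally show ?thesis .
  qed
  then show ?thesis by (simp add: vec_eq_iff)
qed

lemma holomorphic_moebius: "holomorphic_map (moebius) (ball 0 1)"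
  unfolding holomorphic_map_def holomorphic_several_iff
proof (intro allI ballI)
  fix i and z :: "complex^'d" assume "z \<in> ball 0 1"
  then have nz: "1 - hprod z a \<noteq> 0" using one_minus_hprod_nonzero[of z] by simp
  have 1: "((\<lambda>z. hprod z a) has_derivative (\<lambda>v. hprod v a)) (at z within ball 0 1)"
    by (rule bounded_linear_imp_has_derivative[OF bounded_linear_hprod])
  have 2: "((\<lambda>z. z $ i) has_derivative (\<lambda>v. v $ i)) (at z within ball 0 1)"
    by (rule bounded_linear_imp_has_derivative[OF bounded_linear_vec_nth])
  let ?n = "\<lambda>z. (1 - hprod z a * (1 / (1 + s))) * a $ i - s * z $ i"
  let ?n' = "\<lambda>v. - (hprod v a * (1 / (1 + s))) * a $ i - s * v $ i"
  have "(?n has_derivative ?n') (at z within ball 0 1)"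
    by (auto intro!: derivative_eq_intros 1 2 simp: s_nonzero)
  moreover have "((\<lambda>z. 1 - hprod z a) has_derivative (\<lambda>v. - hprod v a)) (at z within ball 0 1)"
    by (auto intro!: derivative_eq_intros 1)
  ultimately have "((\<lambda>z. ?n z / (1 - hprod z a)) has_derivative
      (\<lambda>v. (?n' v * (1 - hprod z a) - ?n z * (- hprod v a)) / ((1 - hprod z a) * (1 - hprod z a))))
      (at z within ball 0 1)"
    using nz by (rule has_derivative_divide')
  moreover have "(\<lambda>z. moebius z $ i) = (\<lambda>z. ?n z / (1 - hprod z a))"
    by (simp add: moebius_nth)
  ultimately show "\<exists>D. ((\<lambda>z. moebius z $ i) has_derivative D) (at z within ball 0 1)
      \<and> (\<forall>c v. D (c *s v) = c * D v)"
    by (intro exI conjI) (assumption | simp add: hprod_scale_left algebra_simps)+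
qed

end

text \<open>Both \<open>b\<close> after \<open>moebius\<close> and its inverse,
  \<open>moebius\<close> after the inverse of \<open>b\<close>, fix 0 and map the ball into itself.
  Schwarz for each of them forces norms to be preserved, hence hermitian products.\<close>

lemma ball_automorphism_kernel:
  assumes "ball_automorphism b"
  obtains a where "norm a < 1"
    "\<And>z w. norm z < 1 \<Longrightarrow> norm w < 1 \<Longrightarrow> 1 - hprod (b z) (b w)
      = of_real (1 - (norm a)\<^sup>2) * (1 - hprod z w) / ((1 - hprod z a) * (1 - hprod a w))"
proof -
  let ?B = "ball 0 1" and ?i = "inv_into (ball 0 1) b"
  have bij: "bij_betw b ?B ?B" and b: "holomorphic_map b ?B" and i: "holomorphic_map ?i ?B"
    using assms by (auto simp: ball_automorphism_def)
  have im: "b ` ?B = ?B" using bij by (simp add: bij_betw_def)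
  have i_im: "?i ` ?B = ?B" using bij_betw_inv_into[OF bij] by (simp add: bij_betw_def)
  have ib: "?i (b z) = z" if "norm z < 1" for z using bij_betw_inv_into_left[OF bij, of z] that by simp
  have bi: "b (?i z) = z" if "norm z < 1" for z using bij_betw_inv_into_right[OF bij, of z] that by simp
  define a where "a = ?i 0"
  have a: "norm a < 1" using i_im by (force simp: a_def)
  interpret moebius_point a by standard (rule a)
  have m_im: "moebius ` ?B \<subseteq> ?B" using norm_moebius by auto
  define f where "f = (\<lambda>z. b (moebius z))"
  define h where "h = (\<lambda>z. moebius (?i z))"
  have f: "holomorphic_map f ?B" unfolding f_def
    by (rule holomorphic_map_compose[OF holomorphic_moebius b m_im])
  have h: "holomorphic_map h ?B" unfolding h_def
    by (rule holomorphic_map_compose[OF i holomorphic_moebius]) (simp add: i_im)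
  have f_im: "f ` ?B \<subseteq> ?B" using m_im im unfolding f_def by blast
  have h_im: "h ` ?B \<subseteq> ?B" using m_im i_im unfolding h_def by blast
  have "b a = 0" using bi[of 0] by (simp add: a_def)
  then have f0: "f 0 = 0" by (simp add: f_def moebius_0)
  have h0: "h 0 = 0" using moebius_self by (simp add: h_def a_def[symmetric])
  have norm_f: "norm (f z) = norm z" if z: "norm z < 1" for z
  proof (rule antisym)
    show "norm (f z) \<le> norm z" by (rule norm_Schwarz[OF f f_im f0 z])
    have "norm (f z) < 1" using f_im z by (auto simp: image_subset_iff)
    then have "norm (h (f z)) \<le> norm (f z)" by (rule norm_Schwarz[OF h h_im h0])
    then show "norm z \<le> norm (f z)"
      using ib[OF norm_moebius[OF z]] moebius_involution[OF z] by (simp add: h_def f_def)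
  qed
  have "1 - hprod (b z) (b w)
      = of_real (1 - (norm a)\<^sup>2) * (1 - hprod z w) / ((1 - hprod z a) * (1 - hprod a w))"
    if z: "norm z < 1" and w: "norm w < 1" for z w
  proof -
    have "b x = f (moebius x)" if "norm x < 1" for x
      using moebius_involution[OF that] by (simp add: f_def)
    then have "hprod (b z) (b w) = hprod (moebius z) (moebius w)"
      using norm_preserving_imp_hprod_preserving[OF f f0 norm_f norm_moebius[OF z] norm_moebius[OF w]]
        z w by simp
    moreover have "s\<^sup>2 = of_real (1 - (norm a)\<^sup>2)" by (simp add: s_power2 hprod_self)
    ultimately show ?thesis using one_minus_hprod_moebius[OF z w] by simp
  qed
  then show ?thesis using that a by blast
qed

section \<open>The compact embedding\<close>

lemma pairing_cong:
  assumes "y \<in> fin_coeffs X" "\<And>x. x \<in> X \<Longrightarrow> F x = G x"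
  shows "pairing F y = pairing G y"
  unfolding pairing_def by (rule sum.cong) (use assms in \<open>auto simp: fin_coeffs_def\<close>)

lemma words_less_finite: "finite {I :: 'd::finite list. length I < N}"
proof -
  have "{I :: 'd list. length I < N} \<subseteq> {I. set I \<subseteq> UNIV \<and> length I \<le> N}" by auto
  then show ?thesis by (rule finite_subset) (rule finite_lists_length_le[OF finite_class.finite_UNIV])
qed

lemma sum_words_less: "(\<Sum>I | length I < N. f I) = (\<Sum>n<N. \<Sum>I | length I = n. f I)"
  for f :: "'d::finite list \<Rightarrow> 'b::comm_monoid_add"
proof -
  have "(\<Sum>n<N. \<Sum>I\<in>{I\<in>{I. length I < N}. length I = n}. f I) = (\<Sum>I | length I < N. f I)"
    by (rule sum.group) (auto simp: words_less_finite)
  moreover have "{I\<in>{I :: 'd list. length I < N}. length I = n} = {I. length I = n}" if "n < N" for n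
    using that by auto
  ultimately show ?thesis by simp
qed

theorem proposition10:
  fixes \<beta> :: real and b :: "complex^'d \<Rightarrow> complex^'d"
    and H Hb :: "(complex^'d \<Rightarrow> complex) set"
    and ip ipb :: "(complex^'d \<Rightarrow> complex) \<Rightarrow> (complex^'d \<Rightarrow> complex) \<Rightarrow> complex"
  assumes "\<beta> > 1"
    and "ball_automorphism b"
    and "is_H_beta \<beta> H ip"
    and "is_H_beta_b \<beta> b Hb ipb"
  shows "compactly_embedded Hb ipb H ip"
proof -
  let ?X = "ball 0 1 :: (complex^'d) set"
  let ?V = "fin_coeffs ?X"
  let ?L = "\<lambda>z w. s_kernel \<beta> z w * (1 - hprod (b z) (b w))"
  have "hilbert_function_space ?X H ip (s_kernel \<beta>)"
    using assms(3) by (simp add: is_H_beta_def)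
  then interpret S: weighted_ball_space H ip \<beta>
    using assms(1) by (simp add: weighted_ball_space_def weighted_ball_space_axioms_def)
  interpret B: hilbert_function_space ?X Hb ipb ?L
    using assms(4) by (simp add: is_H_beta_b_def)
  obtain a where a: "norm a < 1" and ker: "\<And>z w. norm z < 1 \<Longrightarrow> norm w < 1 \<Longrightarrow> 1 - hprod (b z) (b w)
      = of_real (1 - (norm a)\<^sup>2) * (1 - hprod z w) / ((1 - hprod z a) * (1 - hprod a w))"
    using ball_automorphism_kernel[OF assms(2)] by blast
  \<comment> \<open>The square root splits the constant evenly between \<open>g z\<close> and
    \<open>cnj (g w)\<close>.\<close>
  define \<sigma> where "\<sigma> = sqrt (1 - (norm a)\<^sup>2)"
  have \<sigma>: "\<sigma>\<^sup>2 = 1 - (norm a)\<^sup>2" "\<sigma> > 0"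
    using a by (auto simp: \<sigma>_def power_le_one power_less_one_iff)
  define g where "g w = of_real \<sigma> * (1 / (1 - hprod w a))" for w
  \<comment> \<open>A bound for the multiplier \<open>g\<close>: \<open>\<sigma>\<close> times the
    bound \<open>1 / (1 - norm a)\<close> for division by \<open>1 - hprod w a\<close>.\<close>
  define R where "R = \<sigma> / (1 - norm a)"
  have R: "R > 0" using \<sigma> a by (simp add: R_def)
  let ?T = "\<lambda>y w. cnj (g w) * y w"
  let ?c = "neg_binomial_coeff \<beta>" and ?c' = "neg_binomial_coeff (\<beta> - 1)"
  have c_pos: "?c n > 0" "?c' n > 0" for n using neg_binomial_coeff_pos assms(1) by auto
  have c'_eq: "?c' n = (\<beta> - 1) / (\<beta> - 1 + n) * ?c n" for n
    using neg_binomial_coeff_minus_1 assms(1) by auto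
  have c'_le: "?c' n \<le> ?c n" for n
    unfolding c'_eq using c_pos(1)[of n] assms(1) by (intro mult_left_le_one_le) auto

  have kernel_eq: "?L z w = g z * cnj (g w) * s_kernel (\<beta> - 1) z w" if "norm z < 1" "norm w < 1" for z w
  proof -
    have ne: "1 - hprod z w \<noteq> 0" using cmod_hprod_less_1[OF that] by auto
    have "s_kernel (\<beta> - 1) z w = (1 - hprod z w) powr (- of_real \<beta> + 1)"
      by (simp add: s_kernel_def)
    also have "\<dots> = s_kernel \<beta> z w * (1 - hprod z w)"
      unfolding powr_add s_kernel_def using ne by simp
    finally have 1: "s_kernel (\<beta> - 1) z w = s_kernel \<beta> z w * (1 - hprod z w)" .
    have "cnj (1 - hprod w a) = 1 - hprod a w" using hprod_commute[of a w] by simp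
    then have "g z * cnj (g w) = of_real (\<sigma>\<^sup>2) / ((1 - hprod z a) * (1 - hprod a w))"
      by (simp add: g_def power2_eq_square)
    then show ?thesis unfolding 1 ker[OF that] \<sigma> by simp
  qed

  have T_mem: "?T y \<in> ?V" if "y \<in> ?V" for y using fin_coeffs_mult[OF that] .
  have T_norm: "ip_norm ip (S.comb (?T y)) \<le> R * ip_norm ip (S.comb y)" if y: "y \<in> ?V" for y
  proof -
    let ?y = "\<lambda>w. cnj (1 / (1 - hprod w a)) * y w"
    have y': "?y \<in> ?V" using fin_coeffs_mult[OF y] .
    have "?T y = (\<lambda>w. of_real \<sigma> * ?y w)" by (simp add: g_def fun_eq_iff)
    then have "ip_norm ip (S.comb (?T y)) = \<sigma> * ip_norm ip (S.comb ?y)"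
      using S.comb_scale[OF y', of "of_real \<sigma>"] S.ip_norm_scale[OF S.comb_mem[OF y'], of "of_real \<sigma>"] \<sigma>
      by simp
    also have "\<dots> \<le> \<sigma> * (ip_norm ip (S.comb y) / (1 - norm a))"
      using S.norm_comb_divide_hprod[OF y a] \<sigma> by (intro mult_left_mono) auto
    finally show ?thesis by (simp add: R_def)
  qed
  have T_norm2: "(ip_norm ip (S.comb (?T y)))\<^sup>2 \<le> (R * ip_norm ip (S.comb y))\<^sup>2" if "y \<in> ?V" for y
    by (rule power_mono[OF T_norm[OF that] S.ip_norm_nonneg[OF S.comb_mem[OF T_mem[OF that]]]])
  note S_sums = S.norm_comb_sums[OF T_mem]
  have B_sums: "(\<lambda>n. ?c' n * homogeneous_form n (?T y)) sums (ip_norm ipb (B.comb y))\<^sup>2" if y: "y \<in> ?V" for y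
  proof -
    have g0: "g w \<noteq> 0" if "y w \<noteq> 0" for w
    proof -
      have "norm w < 1" using that y by (auto simp: fin_coeffs_def)
      then have "1 - hprod w a \<noteq> 0" using cmod_hprod_less_1[OF _ a, of w] by auto
      then show ?thesis using \<sigma> by (simp add: g_def)
    qed
    \<comment> \<open>\<open>g\<close> has no zeros on the support of \<open>y\<close>, so the
      double sums for \<open>y\<close> and \<open>?T y\<close> run over the same points.\<close>
    then have supp: "{w. ?T y w \<noteq> 0} = {w. y w \<noteq> 0}" by auto
    have "complex_of_real ((ip_norm ipb (B.comb y))\<^sup>2)
        = (\<Sum>z | y z \<noteq> 0. \<Sum>w | y w \<noteq> 0. cnj (y z) * y w * ?L z w)"
      by (rule B.norm_comb_power2[OF y])
    also have "\<dots> = (\<Sum>z | y z \<noteq> 0. \<Sum>w | y w \<noteq> 0. cnj (?T y z) * ?T y w * s_kernel (\<beta> - 1) z w)"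
    proof (intro sum.cong refl)
      fix z w assume "z \<in> {w. y w \<noteq> 0}" "w \<in> {w. y w \<noteq> 0}"
      then have "norm z < 1" "norm w < 1" using y by (auto simp: fin_coeffs_def)
      from kernel_eq[OF this] show "cnj (y z) * y w * ?L z w = cnj (?T y z) * ?T y w * s_kernel (\<beta> - 1) z w"
        by simp
    qed
    finally have "(\<lambda>n. complex_of_real (?c' n * homogeneous_form n (?T y))) sums
        complex_of_real ((ip_norm ipb (B.comb y))\<^sup>2)"
      using s_kernel_form_sums[OF T_mem[OF y], of "\<beta> - 1"] unfolding supp by simp
    then show ?thesis by (simp only: sums_of_real_iff)
  qed
  have B_le: "ip_norm ipb (B.comb y) \<le> R * ip_norm ip (S.comb y)" if y: "y \<in> ?V" for y
  proof (rule power2_le_imp_le)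
    have "(ip_norm ipb (B.comb y))\<^sup>2 \<le> (ip_norm ip (S.comb (?T y)))\<^sup>2"
      by (rule sums_le[OF _ B_sums[OF y] S_sums[OF y]])
        (intro mult_right_mono c'_le homogeneous_form_nonneg)
    also note T_norm2[OF y]
    finally show "(ip_norm ipb (B.comb y))\<^sup>2 \<le> (R * ip_norm ip (S.comb y))\<^sup>2" .
    show "0 \<le> R * ip_norm ip (S.comb y)" using R S.ip_norm_nonneg[OF S.comb_mem[OF y]] by simp
  qed
  have pairing_le: "cmod (pairing f y) \<le> ip_norm ipb f * ip_norm ipb (B.comb y)" if "f \<in> Hb" "y \<in> ?V" for f y
    using B.norm_ip_le[OF that(1) B.comb_mem[OF that(2)]] B.ip_comb[OF that(2,1)] by simp

  have "Hb \<subseteq> H"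
  proof
    fix f assume f: "f \<in> Hb"
    show "f \<in> H"
    proof (rule S.mem_of_bounded_pairing(1))
      show "f x = 0" if "x \<notin> ?X" for x using B.outside[OF f that] .
      show "cmod (pairing f y) \<le> (ip_norm ipb f * R) * ip_norm ip (S.comb y)" if y: "y \<in> ?V" for y
        using pairing_le[OF f y] mult_left_mono[OF B_le[OF y] B.ip_norm_nonneg[OF f]]
        by (simp add: mult.assoc)
    qed
  qed
  moreover
  \<comment> \<open>Over all words, the products \<open>e I z * cnj (e I w)\<close> add up to the
    kernel of \<open>Hb\<close>; the words of length below \<open>N\<close> give the finite rank
    approximation.\<close>
  define e where "e I z = (if z \<in> ?X then of_real (sqrt (?c' (length I))) * (g z * word_monomial I z) else 0)"
    for I z
  have e_pairing: "(cmod (pairing (e I) y))\<^sup>2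
      = ?c' (length I) * (cmod (pairing (word_monomial I) (?T y)))\<^sup>2" if y: "y \<in> ?V" for I y
  proof -
    have "pairing (e I) y = pairing (\<lambda>z. of_real (sqrt (?c' (length I))) * (g z * word_monomial I z)) y"
      by (rule pairing_cong[OF y]) (simp add: e_def)
    also have "\<dots> = of_real (sqrt (?c' (length I))) * pairing (word_monomial I) (?T y)"
      by (simp add: pairing_scale_left pairing_mult[OF y])
    finally show ?thesis
      using c_pos(2)[of "length I"] by (simp add: norm_mult power_mult_distrib)
  qed
  have e_mem: "e I \<in> H" for I
  proof (rule S.mem_of_bounded_pairing(1))
    show "e I x = 0" if "x \<notin> ?X" for x using that by (simp add: e_def)
    show "cmod (pairing (e I) y) \<le> R * ip_norm ip (S.comb y)" if y: "y \<in> ?V" for y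
    proof (rule power2_le_imp_le)
      let ?n = "length I"
      \<comment> \<open>A single word is one square in the form of its degree, and that degree is
        one term of the series for the norm.\<close>
      have "(cmod (pairing (word_monomial I) (?T y)))\<^sup>2 \<le> homogeneous_form ?n (?T y)"
        unfolding homogeneous_form_def
        by (rule member_le_sum) (simp_all add: finite_subset[OF _ words_less_finite[of "Suc ?n"]] subset_iff)
      then have "(cmod (pairing (e I) y))\<^sup>2 \<le> ?c ?n * homogeneous_form ?n (?T y)"
        unfolding e_pairing[OF y] by (intro mult_mono c'_le) (use c_pos(1)[of ?n] in auto)
      also have "\<dots> \<le> (ip_norm ip (S.comb (?T y)))\<^sup>2"
      proof -
        have "0 \<le> ?c n * homogeneous_form n (?T y)" for n
          using c_pos(1)[of n] homogeneous_form_nonneg[of n "?T y"] by simp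
        then have "(\<Sum>n\<in>{?n}. ?c n * homogeneous_form n (?T y)) \<le> (\<Sum>n. ?c n * homogeneous_form n (?T y))"
          by (intro sum_le_suminf sums_summable[OF S_sums[OF y]]) auto
        then show ?thesis unfolding sums_unique[OF S_sums[OF y], symmetric] by simp
      qed
      also note T_norm2[OF y]
      finally show "(cmod (pairing (e I) y))\<^sup>2 \<le> (R * ip_norm ip (S.comb y))\<^sup>2" .
      show "0 \<le> R * ip_norm ip (S.comb y)" using R S.ip_norm_nonneg[OF S.comb_mem[OF y]] by simp
    qed
  qed
  have "compactin S.mtopology (S.mtopology closure_of {f \<in> Hb. ip_norm ipb f \<le> 1})"
  proof (rule S.compact_closure_of_finite_rank_bounds[where e = e and C = R])
    show "f x = 0" if "f \<in> {f \<in> Hb. ip_norm ipb f \<le> 1}" "x \<notin> ?X" for f x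
      using that B.outside by blast
    have unit: "cmod (pairing f y) \<le> ip_norm ipb (B.comb y)"
      if "f \<in> {f \<in> Hb. ip_norm ipb f \<le> 1}" "y \<in> ?V" for f y
    proof -
      have "ip_norm ipb f * ip_norm ipb (B.comb y) \<le> 1 * ip_norm ipb (B.comb y)"
        using that B.ip_norm_nonneg[OF B.comb_mem] by (intro mult_right_mono) auto
      then show ?thesis using pairing_le[of f y] that by auto
    qed
    show "cmod (pairing f y) \<le> R * ip_norm ip (S.comb y)"
      if "f \<in> {f \<in> Hb. ip_norm ipb f \<le> 1}" "y \<in> ?V" for f y
      using unit[OF that] B_le[OF that(2)] by linarith
    show "R \<ge> 0" using R by simp
    show "e I \<in> H" for I by (rule e_mem)
    fix \<epsilon> :: real assume \<epsilon>: "\<epsilon> > 0"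
    \<comment> \<open>The division absorbs the factor \<open>R\<^sup>2\<close> lost when
      \<open>?T y\<close> is replaced by \<open>y\<close>.\<close>
    define \<epsilon>' where "\<epsilon>' = \<epsilon> / R\<^sup>2"
    have \<epsilon>': "\<epsilon>' > 0" using \<epsilon> R by (simp add: \<epsilon>'_def)
    obtain N :: nat where N: "(\<beta> - 1) / \<epsilon>' < real N" using reals_Archimedean2 by blast
    have tail: "?c' n \<le> \<epsilon>' * ?c n" if "N \<le> n" for n
    proof -
      have "(\<beta> - 1) < \<epsilon>' * real N" using N \<epsilon>' by (simp add: pos_divide_less_eq mult.commute)
      also have "\<dots> \<le> \<epsilon>' * (\<beta> - 1 + n)" using that assms(1) \<epsilon>' by (intro mult_left_mono) auto
      finally have "(\<beta> - 1) / (\<beta> - 1 + n) \<le> \<epsilon>'" using assms(1) by (simp add: pos_divide_le_eq)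
      then show ?thesis unfolding c'_eq using c_pos(1)[of n] by (intro mult_right_mono) auto
    qed
    have "(cmod (pairing f y))\<^sup>2 \<le> \<epsilon> * (ip_norm ip (S.comb y))\<^sup>2
        + (\<Sum>I | length I < N. (cmod (pairing (e I) y))\<^sup>2)"
      if f: "f \<in> {f \<in> Hb. ip_norm ipb f \<le> 1}" and y: "y \<in> ?V" for f y
    proof -
      let ?h = "\<lambda>n. homogeneous_form n (?T y)"
      have "(\<Sum>I | length I < N. (cmod (pairing (e I) y))\<^sup>2) = (\<Sum>n<N. ?c' n * ?h n)"
        unfolding sum_words_less e_pairing[OF y] homogeneous_form_def sum_distrib_left
        by (intro sum.cong refl) simp
      \<comment> \<open>The finite sum is padded to a series: degrees below \<open>N\<close> are
        covered by it and the others by the tail estimate, in one termwise comparison.\<close>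
      moreover have "(\<lambda>n. if n \<in> {..<N} then ?c' n * ?h n else 0) sums (\<Sum>n<N. ?c' n * ?h n)"
        by (rule sums_If_finite_set) simp
      ultimately have fin: "(\<lambda>n. if n \<in> {..<N} then ?c' n * ?h n else 0) sums
          (\<Sum>I | length I < N. (cmod (pairing (e I) y))\<^sup>2)" by simp
      have "(ip_norm ipb (B.comb y))\<^sup>2 \<le> \<epsilon>' * (ip_norm ip (S.comb (?T y)))\<^sup>2
          + (\<Sum>I | length I < N. (cmod (pairing (e I) y))\<^sup>2)"
      proof (rule sums_le[OF _ B_sums[OF y] sums_add[OF sums_mult[OF S_sums[OF y]] fin]])
        show "?c' n * ?h n \<le> \<epsilon>' * (?c n * ?h n) + (if n \<in> {..<N} then ?c' n * ?h n else 0)" for n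
        proof (cases "n < N")
          case True
          then show ?thesis using \<epsilon>' c_pos(1)[of n] homogeneous_form_nonneg[of n "?T y"] by simp
        next
          case False
          then have "?c' n * ?h n \<le> \<epsilon>' * ?c n * ?h n"
            using tail[of n] by (intro mult_right_mono homogeneous_form_nonneg) simp
          then show ?thesis using False by (simp add: mult.assoc)
        qed
      qed
      moreover have "\<epsilon>' * (ip_norm ip (S.comb (?T y)))\<^sup>2 \<le> \<epsilon> * (ip_norm ip (S.comb y))\<^sup>2"
        using mult_left_mono[OF T_norm2[OF y], of \<epsilon>'] \<epsilon>' R by (simp add: \<epsilon>'_def power_mult_distrib)
      moreover have "(cmod (pairing f y))\<^sup>2 \<le> (ip_norm ipb (B.comb y))\<^sup>2"
        using unit[OF f y] by (intro power_mono) auto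
      ultimately show ?thesis by linarith
    qed
    then show "\<exists>J. finite J \<and> (\<forall>f\<in>{f \<in> Hb. ip_norm ipb f \<le> 1}. \<forall>y\<in>?V.
        (cmod (pairing f y))\<^sup>2 \<le> \<epsilon> * (ip_norm ip (S.comb y))\<^sup>2 + (\<Sum>I\<in>J. (cmod (pairing (e I) y))\<^sup>2))"
      using words_less_finite[of N] by blast
  qed
  ultimately show ?thesis
    unfolding compactly_embedded_def Let_def by blast
qed

end
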